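(* Let $P(t)$ be a symmetric univariate $n\times n$ polynomial matrix (with real coefficients) of degree $d$. (a) If $d$ is odd, then $P(t)\succeq 0$ for all $t\in[-1,1]$ if and only if there exist positive semidefinite matrices $Q_1,Q_2$, each of size $\left(\frac{d+1}{2}\right)n\times\left(\frac{d+1}{2}\right)n$, and symmetric $n\times n$ univariate polynomial matrices $X_1(t),X_2(t)$ such that, for all $t\in\mathbb{R}$ and all $y\in\mathbb{R}^n$, $$P(t)=(t+1)X_1(t)+(1-t)X_2(t),\qquad y^TX_i(t)y=v_{\frac{d-1}{2}}(t,y)^T\,Q_i\,v_{\frac{d-1}{2}}(t,y)\quad (i=1,2).$$ (b) If $d$ is even, then $P(t)\succeq 0$ for all $t\in[-1,1]$ if and only if there exist positive semidefinite matrices $Q_1,Q_2$ of sizes $\left(\frac d2+1\right)n\times\left(\frac d2+1\right)n$ and $\left(\frac d2\right)n\times\left(\frac d2\right)n$ respectively, and symmetric $n\times n$ univariate polynomial matrices $X_1(t),X_2(t)$ such that, for all $t\in\mathbb{R}$ and all $y\in\mathbb{R}^n$, $$P(t)=X_1(t)+(1-t^2)X_2(t),\qquad y^TX_1(t)y=v_{\frac d2}(t,y)^TQ_1v_{\frac d2}(t,y),\qquad y^TX_2(t)y=v_{\frac d2-1}(t,y)^TQ_2v_{\frac d2-1}(t,y).$$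
   Context: For a nonnegative integer $d'$, $t\in\mathbb{R}$ and $y=(y_1,\dots,y_n)^T\in\mathbb{R}^n$, let $$v_{d'}(t,y):=\left(y_1,\dots,y_n,\,y_1t,\dots,y_nt,\,\dots,\,y_1t^{d'},\dots,y_nt^{d'}\right)^T\in\mathbb{R}^{(d'+1)n}$$ be the vector of all monomials $y_\ell t^k$ with $\ell=1,\dots,n$ and $k=0,\dots,d'$. For $d'=-1$, $v_{-1}$ is the empty vector (so when $d=0$ the matrix $Q_2$ is empty and $X_2=0$). $M\succeq 0$ means that the symmetric matrix $M$ is positive semidefinite. *)

theory Defs
  imports
    Complex_Main
    "HOL-Computational_Algebra.Polynomial"
    "Jordan_Normal_Form.Matrix"
begin

definition symmetric_mat :: "'a mat \<Rightarrow> bool" where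
  "symmetric_mat A \<longleftrightarrow> A\<^sup>T = A"

definition psd_mat :: "real mat \<Rightarrow> bool" where
  "psd_mat A \<longleftrightarrow> symmetric_mat A \<and> (\<forall>x \<in> carrier_vec (dim_row A). 0 \<le> x \<bullet> (A *\<^sub>v x))"

definition eval_poly_mat :: "real poly mat \<Rightarrow> real \<Rightarrow> real mat" where
  "eval_poly_mat P t = map_mat (\<lambda>p. poly p t) P"

(* The largest degree of an entry. Inserting 0 only matters for the 0 x 0 matrix; like
   Polynomial.degree, this assigns degree 0 to the zero matrix. *)
definition degree_poly_mat :: "real poly mat \<Rightarrow> nat" where
  "degree_poly_mat P = Max (insert 0 (degree ` elements_mat P))"

(* Entry k * n + l, where n = dim_vec y, is y_l * t^k, for l = 0..n-1 and k = 0..d'.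
   The index d' is an integer, so that d' = -1 gives the empty vector. *)
definition monom_vec :: "int \<Rightarrow> real \<Rightarrow> real vec \<Rightarrow> real vec" where
  "monom_vec d' t y =
     vec (nat (d' + 1) * dim_vec y) (\<lambda>i. y $ (i mod dim_vec y) * t ^ (i div dim_vec y))"

end

theory Submission
  imports Defs "HOL-Analysis.Function_Topology"
begin

text \<open>
  The certificate gives positivity because both weights are nonnegative on the interval. The
  content is the converse, and the way there is to move the interval to a circle. Every
  \<open>t \<in> [-1, 1]\<close> is \<open>c\<^sup>2 - s\<^sup>2\<close> for a point \<open>(c, s)\<close> of the unit circle, so a polynomial matrix
  of degree \<open>d\<close> turns into a matrix \<open>H\<close> of binary forms of degree \<open>2 d\<close>, positive semidefinite
  on the whole plane. Suppose that \<open>H\<close> is a sum of terms \<open>a a\<^sup>T\<close> with vectors \<open>a\<close> of forms of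
  degree \<open>d\<close>. On the circle \<open>c\<^sup>2 = (1 + t) / 2\<close> and \<open>s\<^sup>2 = (1 - t) / 2\<close>, so a form of degree \<open>d\<close> is
  \<open>p(t) + c s q(t)\<close> if \<open>d\<close> is even and \<open>c p(t) + s q(t)\<close> if \<open>d\<close> is odd (\<open>form_split_even\<close>,
  \<open>form_split_odd\<close>). Averaging over \<open>s\<close> and \<open>-s\<close> removes the mixed products, and what remains are
  squares with weights \<open>1\<close> and \<open>c\<^sup>2 s\<^sup>2 = (1 - t\<^sup>2) / 4\<close>, or \<open>(1 + t) / 2\<close> and \<open>(1 - t) / 2\<close>, with the
  degrees required. The matrices \<open>Q\<^sub>1\<close> and \<open>Q\<^sub>2\<close> are Gram matrices of the coefficients.

  So everything rests on \<open>psd_forms_imp_sos_forms\<close>: a positive semidefinite matrix of binary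
  forms is a sum of squares. The proof removes zeros one at a time, and for that it is stated
  with weights: the entry \<open>(i, j)\<close> has degree \<open>m i + m j\<close>. Subtract the largest multiple \<open>\<lambda>\<close> of
  the diagonal matrix with entries \<open>(c\<^sup>2 + s\<^sup>2) ^ m i\<close> that leaves the matrix positive
  semidefinite; the subtracted part is a sum of squares, and by compactness the rest has a
  kernel vector \<open>z\<close> at some point \<open>u\<close> of the circle
  (\<open>psd_forms_subtract_to_zero\<close>). A change of basis that respects the weights makes \<open>z\<close> a basis
  vector, and then a row and column vanish at \<open>u\<close> (\<open>psd_forms_clear_row\<close>). They are divisible by the
  linear form that vanishes at \<open>u\<close>, the diagonal entry even by its square because it is
  nonnegative. Dividing (\<open>psd_forms_divide_row\<close>) lowers one weight by one, or, if that weight is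
  already zero, the row is zero and drops out. Working with forms on the plane treats all
  points of the circle alike: the end points of the interval and a point at infinity are no
  special cases.
\<close>

section \<open>Binary forms\<close>

text \<open>
  The homogeneous real polynomials of degree \<open>k\<close> in two variables, as functions on the plane.
  Peeling off one variable at a time gives all closure properties by induction on the degree,
  and a degree that does not fit is excluded by construction.
\<close>
primrec form :: "nat \<Rightarrow> (real \<times> real \<Rightarrow> real) set" where
  "form 0 = range (\<lambda>a x. a)"
| "form (Suc k) = {\<lambda>x. fst x * g x + snd x * h x | g h. g \<in> form k \<and> h \<in> form k}"

lemma form_const: "(\<lambda>x. a) \<in> form 0"
  by auto

lemma form_SucI: "g \<in> form k \<Longrightarrow> h \<in> form k \<Longrightarrow> (\<lambda>x. fst x * g x + snd x * h x) \<in> form (Suc k)"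
  by auto

lemma form_SucE:
  assumes "f \<in> form (Suc k)"
  obtains g h where "g \<in> form k" "h \<in> form k" "\<And>x. f x = fst x * g x + snd x * h x"
  using assms by auto

lemma form_add: "f \<in> form k \<Longrightarrow> g \<in> form k \<Longrightarrow> (\<lambda>x. f x + g x) \<in> form k"
proof (induction k arbitrary: f g)
  case (Suc k)
  obtain f1 f2 where f: "f1 \<in> form k" "f2 \<in> form k" "\<And>x. f x = fst x * f1 x + snd x * f2 x"
    using form_SucE[OF Suc.prems(1)] by blast
  obtain g1 g2 where g: "g1 \<in> form k" "g2 \<in> form k" "\<And>x. g x = fst x * g1 x + snd x * g2 x"
    using form_SucE[OF Suc.prems(2)] by blast
  show ?case
    using form_SucI[OF Suc.IH[OF f(1) g(1)] Suc.IH[OF f(2) g(2)]]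
    by (simp add: f(3) g(3) algebra_simps)
qed auto

lemma form_scale: "f \<in> form k \<Longrightarrow> (\<lambda>x. a * f x) \<in> form k"
proof (induction k arbitrary: f)
  case (Suc k)
  obtain f1 f2 where f: "f1 \<in> form k" "f2 \<in> form k" "\<And>x. f x = fst x * f1 x + snd x * f2 x"
    using form_SucE[OF Suc.prems(1)] by blast
  show ?case
    using form_SucI[OF Suc.IH[OF f(1)] Suc.IH[OF f(2)]]
    by (simp add: f(3) algebra_simps)
qed auto

lemma form_zero: "(\<lambda>x. 0) \<in> form k"
  by (induction k) (use form_SucI in force)+

lemma form_diff: "f \<in> form k \<Longrightarrow> g \<in> form k \<Longrightarrow> (\<lambda>x. f x - g x) \<in> form k"
  using form_add[of f k "\<lambda>x. (-1) * g x"] form_scale[of g k "-1"] by simp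

lemma form_sum:
  "(\<And>i. i \<in> I \<Longrightarrow> f i \<in> form k) \<Longrightarrow> (\<lambda>x. \<Sum>i\<in>I. f i x) \<in> form k"
  by (induction I rule: infinite_finite_induct) (auto intro: form_zero form_add)

lemma form_mult: "f \<in> form k \<Longrightarrow> g \<in> form l \<Longrightarrow> (\<lambda>x. f x * g x) \<in> form (k + l)"
proof (induction k arbitrary: f)
  case 0
  then show ?case by (auto intro: form_scale)
next
  case (Suc k)
  obtain f1 f2 where f: "f1 \<in> form k" "f2 \<in> form k" "\<And>x. f x = fst x * f1 x + snd x * f2 x"
    using form_SucE[OF Suc.prems(1)] by blast
  show ?case
    using form_SucI[OF Suc.IH[OF f(1) Suc.prems(2)] Suc.IH[OF f(2) Suc.prems(2)]]
    by (simp add: f(3) algebra_simps)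
qed

lemma form_power: "f \<in> form k \<Longrightarrow> (\<lambda>x. f x ^ j) \<in> form (k * j)"
proof (induction j)
  case (Suc j)
  then show ?case using form_mult[of f k "\<lambda>x. f x ^ j" "k * j"] by simp
qed auto

lemma form_linear: "(\<lambda>x. a * fst x + b * snd x) \<in> form 1"
  using form_SucI[OF form_const[of a] form_const[of b]] by (simp add: mult.commute)

lemma form_quadratic: "(\<lambda>x. a * (fst x)\<^sup>2 + b * (snd x)\<^sup>2) \<in> form 2"
  using form_SucI[OF form_linear[of a 0] form_linear[of 0 b]]
  by (simp add: power2_eq_square algebra_simps numeral_2_eq_2)

lemma form_homogeneous: "f \<in> form k \<Longrightarrow> f (r * fst x, r * snd x) = r ^ k * f x"
proof (induction k arbitrary: f)
  case (Suc k)
  obtain f1 f2 where f: "f1 \<in> form k" "f2 \<in> form k" "\<And>x. f x = fst x * f1 x + snd x * f2 x"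
    using form_SucE[OF Suc.prems(1)] by blast
  show ?case
    using Suc.IH[OF f(1)] Suc.IH[OF f(2)] by (simp add: f(3) algebra_simps)
qed auto

lemma form_continuous: "f \<in> form k \<Longrightarrow> continuous_on S f"
proof (induction k arbitrary: f)
  case (Suc k)
  obtain f1 f2 where f: "f1 \<in> form k" "f2 \<in> form k" "\<And>x. f x = fst x * f1 x + snd x * f2 x"
    using form_SucE[OF Suc.prems(1)] by blast
  have "continuous_on S (\<lambda>x. fst x * f1 x + snd x * f2 x)"
    by (intro continuous_intros Suc.IH f)
  then show ?case using f(3) by presburger
qed auto

definition norm_sq :: "real \<times> real \<Rightarrow> real" where
  "norm_sq x = (fst x)\<^sup>2 + (snd x)\<^sup>2"

text \<open>
  The coordinates of \<open>x\<close> in the orthonormal frame given by a unit vector \<open>u\<close> and its rotation by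
  a right angle. The second coordinate is the linear form that vanishes on the line through \<open>u\<close>.
\<close>
definition along :: "real \<times> real \<Rightarrow> real \<times> real \<Rightarrow> real" where
  "along u x = fst u * fst x + snd u * snd x"

definition across :: "real \<times> real \<Rightarrow> real \<times> real \<Rightarrow> real" where
  "across u x = fst u * snd x - snd u * fst x"

lemma form_along: "along u \<in> form 1"
  using form_linear[of "fst u" "snd u"] by (simp add: along_def[abs_def])

lemma form_across: "across u \<in> form 1"
  using form_linear[of "- snd u" "fst u"] by (simp add: across_def[abs_def] algebra_simps)

lemma form_norm_sq: "norm_sq \<in> form 2"
  using form_quadratic[of 1 1] by (simp add: norm_sq_def[abs_def])

lemma fst_eq_along_across:
  assumes "norm_sq u = 1"
  shows "fst x = fst u * along u x - snd u * across u x"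
proof -
  have "fst x * norm_sq u = fst u * along u x - snd u * across u x"
    unfolding norm_sq_def along_def across_def by (simp add: algebra_simps power2_eq_square)
  then show ?thesis using assms by simp
qed

lemma snd_eq_along_across:
  assumes "norm_sq u = 1"
  shows "snd x = snd u * along u x + fst u * across u x"
proof -
  have "snd x * norm_sq u = snd u * along u x + fst u * across u x"
    unfolding norm_sq_def along_def across_def by (simp add: algebra_simps power2_eq_square)
  then show ?thesis using assms by simp
qed

text \<open>
  In the frame of \<open>u\<close>, all terms of a form except the pure power of the first coordinate
  contain the second one as a factor; the coefficient of that power is the value at \<open>u\<close>.
\<close>
lemma form_expand_at:
  assumes u: "norm_sq u = 1" and "f \<in> form (Suc k)"
  shows "\<exists>g \<in> form k. \<forall>x. f x = f u * along u x ^ Suc k + across u x * g x"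
  using assms(2)
proof (induction k arbitrary: f)
  case 0
  then obtain a b where f: "\<And>x. f x = fst x * a + snd x * b"
    by auto
  have "f x = f u * along u x + across u x * (fst u * b - snd u * a)" for x
    unfolding f fst_eq_along_across[OF u, of x] snd_eq_along_across[OF u, of x]
    by (simp add: algebra_simps)
  then show ?case using form_const by force
next
  case (Suc k)
  obtain f1 f2 where f: "f1 \<in> form (Suc k)" "f2 \<in> form (Suc k)"
      "\<And>x. f x = fst x * f1 x + snd x * f2 x"
    using form_SucE[OF Suc.prems(1)] by blast
  obtain g1 where g1: "g1 \<in> form k" "\<And>x. f1 x = f1 u * along u x ^ Suc k + across u x * g1 x"
    using Suc.IH[OF f(1)] by blast
  obtain g2 where g2: "g2 \<in> form k" "\<And>x. f2 x = f2 u * along u x ^ Suc k + across u x * g2 x"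
    using Suc.IH[OF f(2)] by blast
  define g where "g x = (fst u * f2 x - snd u * f1 x) + along u x * (fst u * g1 x + snd u * g2 x)" for x
  have "g \<in> form (Suc k)"
    unfolding g_def[abs_def]
    using form_mult[OF form_along, of "\<lambda>x. fst u * g1 x + snd u * g2 x" k u]
    by (intro form_add form_diff form_scale f) (simp add: form_add form_scale g1 g2)
  moreover have "f x = f u * along u x ^ Suc (Suc k) + across u x * g x" for x
  proof -
    have "f x = along u x * (fst u * f1 x + snd u * f2 x) + across u x * (fst u * f2 x - snd u * f1 x)"
      unfolding f(3) fst_eq_along_across[OF u, of x] snd_eq_along_across[OF u, of x]
      by (simp add: algebra_simps)
    also have "fst u * f1 x + snd u * f2 x =
        f u * along u x ^ Suc k + across u x * (fst u * g1 x + snd u * g2 x)"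
      unfolding f(3)[of u] g1(2)[of x] g2(2)[of x] by (simp add: algebra_simps)
    finally show ?thesis
      by (simp add: g_def algebra_simps)
  qed
  ultimately show ?case by blast
qed

lemma form_divide_across:
  assumes "norm_sq u = 1" "f \<in> form (Suc k)" "f u = 0"
  obtains g where "g \<in> form k" "\<And>x. f x = across u x * g x"
  using form_expand_at[OF assms(1,2)] assms(3) by auto

text \<open>
  A step transverse to the line through \<open>u\<close>. Limits along it are used to reach that line from
  the outside, where division by \<open>across u\<close> is possible.
\<close>
definition nudge :: "real \<times> real \<Rightarrow> real \<times> real \<Rightarrow> real \<Rightarrow> real \<times> real" where
  "nudge u x e = (fst x - e * snd u, snd x + e * fst u)"

lemma across_nudge:
  assumes "norm_sq u = 1"
  shows "across u (nudge u x e) = across u x + e"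
proof -
  have "across u (nudge u x e) = across u x + e * norm_sq u"
    unfolding norm_sq_def across_def nudge_def by (simp add: algebra_simps power2_eq_square)
  then show ?thesis using assms by simp
qed

lemma nudge_tendsto:
  fixes f :: "real \<times> real \<Rightarrow> real"
  assumes "continuous_on UNIV f"
  shows "((\<lambda>e. f (nudge u x e)) \<longlongrightarrow> f x) (at 0 within S)"
proof -
  have "continuous_on UNIV (\<lambda>e. f (nudge u x e))"
    unfolding nudge_def by (intro continuous_on_compose2[OF assms] continuous_intros) auto
  then have "((\<lambda>e. f (nudge u x e)) \<longlongrightarrow> f (nudge u x 0)) (at 0)"
    by (simp add: continuous_on_def)
  then have "((\<lambda>e. f (nudge u x e)) \<longlongrightarrow> f x) (at 0)"
    by (simp add: nudge_def)
  then show ?thesis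
    by (rule tendsto_within_subset) simp
qed

lemma nonneg_off_line:
  assumes "norm_sq u = 1" "continuous_on UNIV f" "\<And>x. across u x \<noteq> 0 \<Longrightarrow> 0 \<le> f x"
  shows "0 \<le> (f x :: real)"
proof (cases "across u x = 0")
  case True
  have "eventually (\<lambda>e. 0 \<le> f (nudge u x e)) (at 0)"
    unfolding eventually_at_filter
    by (rule always_eventually) (use True in \<open>auto simp: across_nudge[OF assms(1)] intro!: assms(3)\<close>)
  then show ?thesis
    by (rule tendsto_lowerbound[OF nudge_tendsto[OF assms(2)]]) simp
qed (use assms in auto)

text \<open>
  A nonnegative form cannot change sign at a zero, so the zero is double: after the first
  division the quotient is nonnegative on one side of the line and nonpositive on the other,
  hence it vanishes at \<open>u\<close> as well.
\<close>
lemma nonneg_form_divide_across_sq: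
  assumes u: "norm_sq u = 1" and f: "f \<in> form (Suc (Suc k))" and nn: "\<And>x. 0 \<le> f x" and "f u = 0"
  obtains g where "g \<in> form k" "\<And>x. f x = (across u x)\<^sup>2 * g x"
proof -
  obtain g where g: "g \<in> form (Suc k)" "\<And>x. f x = across u x * g x"
    using form_divide_across[OF u f \<open>f u = 0\<close>] by blast
  have cont: "continuous_on UNIV g" using form_continuous[OF g(1)] .
  have across: "across u (nudge u u e) = e" for e
    using across_nudge[OF u] by (simp add: across_def)
  have "0 \<le> g (nudge u u e)" if "e > 0" for e
    using nn[of "nudge u u e"] that by (simp add: g(2) across zero_le_mult_iff)
  then have "\<forall>\<^sub>F e in at_right 0. 0 \<le> g (nudge u u e)"
    unfolding eventually_at_filter by (intro always_eventually) simp
  then have "0 \<le> g u"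
    by (rule tendsto_lowerbound[OF nudge_tendsto[OF cont]]) simp
  moreover have "g (nudge u u e) \<le> 0" if "e < 0" for e
    using nn[of "nudge u u e"] that by (simp add: g(2) across zero_le_mult_iff)
  then have "\<forall>\<^sub>F e in at_left 0. g (nudge u u e) \<le> 0"
    unfolding eventually_at_filter by (intro always_eventually) simp
  then have "g u \<le> 0"
    by (rule tendsto_upperbound[OF nudge_tendsto[OF cont]]) simp
  ultimately have "g u = 0" by simp
  then obtain h where "h \<in> form k" "\<And>x. g x = across u x * h x"
    using form_divide_across[OF u g(1)] by blast
  then show ?thesis using that g(2) by (simp add: power2_eq_square)
qed

section \<open>Positive semidefinite quadratic forms\<close>

definition quad :: "'i set \<Rightarrow> ('i \<Rightarrow> 'i \<Rightarrow> real) \<Rightarrow> ('i \<Rightarrow> real) \<Rightarrow> real" where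
  "quad I A z = (\<Sum>i\<in>I. \<Sum>j\<in>I. z i * z j * A i j)"

text \<open>
  The substitution rule \<open>z\<^sup>T (T A T\<^sup>T) w = (T\<^sup>T z)\<^sup>T A (T\<^sup>T w)\<close>. The quadratic form of a congruent
  matrix and the inversion of a congruence are both instances.
\<close>
lemma bilinear_congruence:
  fixes A :: "'i \<Rightarrow> 'i \<Rightarrow> real" and B :: "'k \<Rightarrow> 'k \<Rightarrow> real"
  assumes "\<And>k l. k \<in> J \<Longrightarrow> l \<in> J \<Longrightarrow> B k l = (\<Sum>i\<in>I. \<Sum>j\<in>I. T k i * T l j * A i j)"
  shows "(\<Sum>k\<in>J. \<Sum>l\<in>J. z k * w l * B k l) =
    (\<Sum>i\<in>I. \<Sum>j\<in>I. (\<Sum>k\<in>J. z k * T k i) * (\<Sum>l\<in>J. w l * T l j) * A i j)"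
proof -
  have "(\<Sum>k\<in>J. \<Sum>l\<in>J. z k * w l * B k l) =
      (\<Sum>k\<in>J. \<Sum>l\<in>J. \<Sum>i\<in>I. \<Sum>j\<in>I. (z k * T k i) * (w l * T l j) * A i j)"
    using assms by (simp add: sum_distrib_left mult_ac)
  also have "\<dots> = (\<Sum>k\<in>J. \<Sum>i\<in>I. \<Sum>l\<in>J. \<Sum>j\<in>I. (z k * T k i) * (w l * T l j) * A i j)"
    by (intro sum.cong sum.swap refl)
  also have "\<dots> = (\<Sum>i\<in>I. \<Sum>k\<in>J. \<Sum>l\<in>J. \<Sum>j\<in>I. (z k * T k i) * (w l * T l j) * A i j)"
    by (rule sum.swap)
  also have "\<dots> = (\<Sum>i\<in>I. \<Sum>k\<in>J. \<Sum>j\<in>I. \<Sum>l\<in>J. (z k * T k i) * (w l * T l j) * A i j)"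
    by (intro sum.cong sum.swap refl)
  also have "\<dots> = (\<Sum>i\<in>I. \<Sum>j\<in>I. \<Sum>k\<in>J. \<Sum>l\<in>J. (z k * T k i) * (w l * T l j) * A i j)"
    by (intro sum.cong sum.swap refl)
  also have "\<dots> = (\<Sum>i\<in>I. \<Sum>j\<in>I. (\<Sum>k\<in>J. z k * T k i) * (\<Sum>l\<in>J. w l * T l j) * A i j)"
    unfolding sum_product by (simp only: sum_distrib_right)
  finally show ?thesis .
qed

lemma quad_congruence:
  assumes "\<And>k l. k \<in> J \<Longrightarrow> l \<in> J \<Longrightarrow> B k l = (\<Sum>i\<in>I. \<Sum>j\<in>I. T k i * T l j * A i j)"
  shows "quad J B z = quad I A (\<lambda>i. \<Sum>k\<in>J. z k * T k i)"
  unfolding quad_def by (rule bilinear_congruence) (rule assms)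

lemma congruence_inverse:
  fixes A B :: "'i \<Rightarrow> 'i \<Rightarrow> real"
  assumes "finite I"
    and B: "\<And>k l. k \<in> I \<Longrightarrow> l \<in> I \<Longrightarrow> B k l = (\<Sum>i\<in>I. \<Sum>j\<in>I. T k i * T l j * A i j)"
    and inv: "\<And>i a. i \<in> I \<Longrightarrow> a \<in> I \<Longrightarrow> (\<Sum>k\<in>I. S i k * T k a) = (if a = i then 1 else 0)"
    and ij: "i \<in> I" "j \<in> I"
  shows "A i j = (\<Sum>k\<in>I. \<Sum>l\<in>I. S i k * S j l * B k l)"
proof -
  have "(\<Sum>k\<in>I. \<Sum>l\<in>I. S i k * S j l * B k l) =
      (\<Sum>a\<in>I. \<Sum>b\<in>I. (\<Sum>k\<in>I. S i k * T k a) * (\<Sum>l\<in>I. S j l * T l b) * A a b)"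
    by (rule bilinear_congruence) (rule B)
  also have "\<dots> = (\<Sum>a\<in>I. if a = i then \<Sum>b\<in>I. if b = j then A a b else 0 else 0)"
    by (intro sum.cong refl) (auto simp: inv ij intro!: sum.cong)
  also have "\<dots> = A i j"
    using ij assms(1) by (simp add: sum.delta)
  finally show ?thesis by simp
qed

lemma quad_add_unit:
  assumes "finite I" "k \<in> I" and sym: "\<And>i j. i \<in> I \<Longrightarrow> j \<in> I \<Longrightarrow> A i j = A j i"
  shows "quad I A (\<lambda>i. z i + (if i = k then e else 0)) =
    quad I A z + 2 * e * (\<Sum>j\<in>I. A k j * z j) + e\<^sup>2 * A k k"
proof -
  let ?d = "\<lambda>i. if i = k then e else 0"
  have "quad I A (\<lambda>i. z i + ?d i) =
    quad I A z + (\<Sum>i\<in>I. \<Sum>j\<in>I. z i * (?d j * A i j)) + (\<Sum>i\<in>I. \<Sum>j\<in>I. ?d i * (z j * A i j))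
      + (\<Sum>i\<in>I. \<Sum>j\<in>I. ?d i * (?d j * A i j))"
    unfolding quad_def sum.distrib[symmetric] by (intro sum.cong refl) (simp only: algebra_simps)
  also have "(\<Sum>i\<in>I. \<Sum>j\<in>I. z i * (?d j * A i j)) = e * (\<Sum>j\<in>I. A k j * z j)"
  proof -
    have "(\<Sum>j\<in>I. z i * (?d j * A i j)) = e * (A k i * z i)" if "i \<in> I" for i
    proof -
      have "(\<Sum>j\<in>I. z i * (?d j * A i j)) = (\<Sum>j\<in>I. if j = k then z i * (e * A i j) else 0)"
        by (intro sum.cong) auto
      then show ?thesis using assms(1,2) sym[OF that assms(2)] by (simp add: sum.delta)
    qed
    then show ?thesis by (simp add: sum_distrib_left)
  qed
  also have "(\<Sum>i\<in>I. \<Sum>j\<in>I. ?d i * (z j * A i j)) = e * (\<Sum>j\<in>I. A k j * z j)"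
  proof -
    have "(\<Sum>i\<in>I. \<Sum>j\<in>I. ?d i * (z j * A i j)) =
        (\<Sum>i\<in>I. if i = k then e * (\<Sum>j\<in>I. A i j * z j) else 0)"
      by (intro sum.cong) (auto simp: sum_distrib_left mult_ac)
    then show ?thesis using assms(1,2) by (simp add: sum.delta)
  qed
  also have "(\<Sum>i\<in>I. \<Sum>j\<in>I. ?d i * (?d j * A i j)) = e\<^sup>2 * A k k"
  proof -
    have "(\<Sum>i\<in>I. \<Sum>j\<in>I. ?d i * (?d j * A i j)) =
        (\<Sum>i\<in>I. if i = k then \<Sum>j\<in>I. if j = k then e * (e * A i j) else 0 else 0)"
      by (intro sum.cong refl) (auto intro!: sum.cong)
    then show ?thesis using assms(1,2) by (simp add: sum.delta power2_eq_square)
  qed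
  finally show ?thesis by simp
qed

text \<open>
  Otherwise a small step from \<open>z\<close> in direction \<open>k\<close> would make the form negative, because its
  linear term dominates the quadratic one.
\<close>
lemma psd_isotropic_in_kernel:
  assumes "finite I" "k \<in> I" and sym: "\<And>i j. i \<in> I \<Longrightarrow> j \<in> I \<Longrightarrow> A i j = A j i"
    and psd: "\<And>z. 0 \<le> quad I A z" and zero: "quad I A z = 0"
  shows "(\<Sum>j\<in>I. A k j * z j) = 0"
proof (rule ccontr)
  let ?r = "\<Sum>j\<in>I. A k j * z j"
  assume r: "?r \<noteq> 0"
  have "quad I A (\<lambda>i. 0) = 0" by (simp add: quad_def)
  with psd[of "\<lambda>i. 0 + (if i = k then 1 else 0)"]
    quad_add_unit[where z = "\<lambda>i. 0" and e = 1 and A = A, OF assms(1,2) sym]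
  have a: "0 \<le> A k k" by simp
  \<comment> \<open>Close to the minimiser \<open>-r / A k k\<close> of the quadratic in \<open>e\<close>, but also defined if \<open>A k k = 0\<close>.\<close>
  define e where "e = - ?r / (A k k + 1)"
  have "0 \<le> 2 * e * ?r + e\<^sup>2 * A k k"
    using psd[of "\<lambda>i. z i + (if i = k then e else 0)"] 
      quad_add_unit[where z = z and e = e and A = A, OF assms(1,2) sym] zero
    by simp
  also have "\<dots> = - ?r\<^sup>2 * (A k k + 2) / (A k k + 1)\<^sup>2"
    using a unfolding e_def by (simp add: divide_simps power2_eq_square) (simp add: algebra_simps)
  also have "\<dots> < 0"
    using a r by (intro divide_neg_pos mult_neg_pos) auto
  finally show False by simp
qed

lemma psd_zero_diagonal_zero_row:
  assumes "finite I" "k \<in> I" "j \<in> I" and sym: "\<And>i j. i \<in> I \<Longrightarrow> j \<in> I \<Longrightarrow> A i j = A j i"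
    and psd: "\<And>z. 0 \<le> quad I A z" and zero: "A k k = 0"
  shows "A k j = 0"
proof -
  let ?e = "\<lambda>i. if i = k then 1 else 0"
  have "quad I A (\<lambda>i. 0 + ?e i) = 0"
    using quad_add_unit[where z = "\<lambda>i. 0" and e = 1 and A = A, OF assms(1,2) sym] zero
    by (simp add: quad_def)
  from psd_isotropic_in_kernel[OF assms(1,3) sym psd this]
  have "(\<Sum>i\<in>I. if i = k then A j i else 0) = 0"
    by (simp add: if_distrib cong: if_cong)
  then have "A j k = 0" using assms(1,2) by (simp add: sum.delta)
  then show ?thesis using sym assms(2,3) by simp
qed

text \<open>
  The sphere sits in a function space over an arbitrary index type; setting the coordinates
  outside \<open>I\<close> to zero makes it a closed subset of a product of compact intervals, which is
  compact by Tychonoff's theorem.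
\<close>
lemma compact_unit_sphere_fun:
  assumes "finite I"
  shows "compact {z :: 'i \<Rightarrow> real. (\<forall>i. i \<notin> I \<longrightarrow> z i = 0) \<and> (\<Sum>i\<in>I. (z i)\<^sup>2) = 1}"
proof -
  let ?B = "\<lambda>i. if i \<in> I then {-1..1} else {0::real}"
  let ?S = "{z :: 'i \<Rightarrow> real. (\<Sum>i\<in>I. (z i)\<^sup>2) = 1}"
  have "compactin (product_topology (\<lambda>i. euclidean) UNIV) (PiE UNIV ?B)"
    by (auto simp: compactin_PiE)
  then have "compact (PiE UNIV ?B)"
    by (simp add: euclidean_product_topology)
  moreover have "closed ?S"
    by (intro closed_Collect_eq continuous_intros continuous_on_product_coordinates)
  ultimately have "compact (PiE UNIV ?B \<inter> ?S)"
    by (rule compact_Int_closed)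
  also have "PiE UNIV ?B \<inter> ?S = {z. (\<forall>i. i \<notin> I \<longrightarrow> z i = 0) \<and> (\<Sum>i\<in>I. (z i)\<^sup>2) = 1}"
  proof -
    have "z i \<in> {-1..1}" if "(\<Sum>i\<in>I. (z i)\<^sup>2) = 1" "i \<in> I" for z :: "'i \<Rightarrow> real" and i
    proof -
      have "(z i)\<^sup>2 \<le> 1"
        using member_le_sum[of i I "\<lambda>i. (z i)\<^sup>2"] assms that by simp
      then show ?thesis
        by (simp add: abs_square_le_1 abs_le_iff)
    qed
    then show ?thesis by (auto simp: PiE_def Pi_def split: if_splits)
  qed
  finally show ?thesis .
qed

lemma compact_unit_circle: "compact {u. norm_sq u = 1}"
proof -
  have "closed {u. norm_sq u = 1}"
    unfolding norm_sq_def by (intro closed_Collect_eq continuous_intros)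
  then have "compact (({-1..1} \<times> {-1..1}) \<inter> {u. norm_sq u = 1})"
    by (intro compact_Int_closed compact_Times compact_Icc)
  also have "({-1..1} \<times> {-1..1}) \<inter> {u. norm_sq u = 1} = {u. norm_sq u = 1}"
  proof -
    have "\<bar>a\<bar> \<le> 1 \<and> \<bar>b\<bar> \<le> 1" if "a\<^sup>2 + b\<^sup>2 = 1" for a b :: real
      using that by (simp flip: abs_square_le_1) (smt (verit) zero_le_power2)
    then show ?thesis by (force simp: norm_sq_def abs_le_iff)
  qed
  finally show ?thesis .
qed

text \<open>
  The minimum over circle and sphere is stated homogeneously in \<open>w\<close>, so that it can be
  subtracted without a normalisation.
\<close>
lemma quad_attains_min:
  fixes I :: "'i set" and P :: "'i \<Rightarrow> 'i \<Rightarrow> real \<times> real \<Rightarrow> real"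
  assumes "finite I" "I \<noteq> {}"
    and cont: "\<And>i j. i \<in> I \<Longrightarrow> j \<in> I \<Longrightarrow> continuous_on UNIV (P i j)"
  shows "\<exists>u z. norm_sq u = 1 \<and> (\<Sum>i\<in>I. (z i)\<^sup>2) = 1 \<and>
    (\<forall>x w. norm_sq x = 1 \<longrightarrow>
      quad I (\<lambda>i j. P i j u) z * (\<Sum>i\<in>I. (w i)\<^sup>2) \<le> quad I (\<lambda>i j. P i j x) w)"
proof -
  let ?S = "{z :: 'i \<Rightarrow> real. (\<forall>i. i \<notin> I \<longrightarrow> z i = 0) \<and> (\<Sum>i\<in>I. (z i)\<^sup>2) = 1}"
  let ?K = "{u. norm_sq u = 1} \<times> ?S"
  let ?F = "\<lambda>p. quad I (\<lambda>i j. P i j (fst p)) (snd p)"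
  have "compact ?K"
    by (intro compact_Times compact_unit_circle compact_unit_sphere_fun assms)
  moreover have "?K \<noteq> {}"
  proof -
    obtain k where k: "k \<in> I" using assms by blast
    have "(\<Sum>i\<in>I. (indicator {k} i :: real)\<^sup>2) = (\<Sum>i\<in>I. if i = k then 1 else 0)"
      by (intro sum.cong) auto
    also have "\<dots> = 1" using k assms(1) by (simp add: sum.delta)
    finally have "((1, 0), indicator {k}) \<in> ?K"
      using k by (auto simp: norm_sq_def indicator_eq_0_iff)
    then show ?thesis by blast
  qed
  moreover have "continuous_on ?K ?F"
  proof -
    have coord: "continuous_on ?K (\<lambda>p. snd p i)" for i
      by (rule continuous_on_compose2[OF continuous_on_product_coordinates[of i]])
         (auto intro: continuous_intros)
    show ?thesis
      unfolding quad_def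
      by (intro continuous_on_sum continuous_on_mult coord continuous_on_compose2[OF cont] continuous_on_fst continuous_on_id) auto
  qed
  ultimately obtain p where p: "p \<in> ?K" and min: "\<And>q. q \<in> ?K \<Longrightarrow> ?F p \<le> ?F q"
    using continuous_attains_inf[of ?K ?F] by blast
  let ?u = "fst p" and ?z = "snd p"
  have "?F p * (\<Sum>i\<in>I. (w i)\<^sup>2) \<le> quad I (\<lambda>i j. P i j x) w" if x: "norm_sq x = 1" for x w
  proof (cases "(\<Sum>i\<in>I. (w i)\<^sup>2) = 0")
    case True
    then have "\<forall>i\<in>I. w i = 0" using assms(1) by (simp add: sum_nonneg_eq_0_iff)
    then show ?thesis using True by (simp add: quad_def)
  next
    case False
    define r where "r = sqrt (\<Sum>i\<in>I. (w i)\<^sup>2)"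
    have "0 \<le> (\<Sum>i\<in>I. (w i)\<^sup>2)" by (simp add: sum_nonneg)
    then have r: "r > 0" "r\<^sup>2 = (\<Sum>i\<in>I. (w i)\<^sup>2)" using False by (auto simp: r_def)
    have "(x, \<lambda>i. if i \<in> I then w i / r else 0) \<in> ?K"
      using x r(1) by (simp add: power_divide flip: sum_divide_distrib r(2))
    from min[OF this] have "?F p \<le> quad I (\<lambda>i j. P i j x) (\<lambda>i. if i \<in> I then w i / r else 0)"
      by simp
    also have "\<dots> = quad I (\<lambda>i j. P i j x) w / r\<^sup>2"
      unfolding quad_def by (simp add: sum_divide_distrib power2_eq_square)
    finally show ?thesis using r(1) by (simp add: field_simps flip: r(2))
  qed
  then show ?thesis using p by (intro exI[of _ ?u] exI[of _ ?z]) auto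
qed

section \<open>Matrices of binary forms\<close>

definition psd_forms :: "'i set \<Rightarrow> ('i \<Rightarrow> nat) \<Rightarrow> ('i \<Rightarrow> 'i \<Rightarrow> real \<times> real \<Rightarrow> real) \<Rightarrow> bool" where
  "psd_forms I m P \<longleftrightarrow>
    (\<forall>i\<in>I. \<forall>j\<in>I. P i j \<in> form (m i + m j) \<and> P i j = P j i) \<and>
    (\<forall>x z. 0 \<le> quad I (\<lambda>i j. P i j x) z)"

definition sos_forms :: "'i set \<Rightarrow> ('i \<Rightarrow> nat) \<Rightarrow> ('i \<Rightarrow> 'i \<Rightarrow> real \<times> real \<Rightarrow> real) \<Rightarrow> bool" where
  "sos_forms I m P \<longleftrightarrow>
    (\<exists>as. (\<forall>a\<in>set as. \<forall>i\<in>I. a i \<in> form (m i)) \<and>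
          (\<forall>i\<in>I. \<forall>j\<in>I. \<forall>x. P i j x = (\<Sum>a\<leftarrow>as. a i x * a j x)))"

lemma sos_formsI:
  assumes "\<And>a i. a \<in> set as \<Longrightarrow> i \<in> I \<Longrightarrow> a i \<in> form (m i)"
    "\<And>i j x. i \<in> I \<Longrightarrow> j \<in> I \<Longrightarrow> P i j x = (\<Sum>a\<leftarrow>as. a i x * a j x)"
  shows "sos_forms I m P"
  using assms unfolding sos_forms_def by blast

lemma sos_formsE:
  assumes "sos_forms I m P"
  obtains as where "\<And>a i. a \<in> set as \<Longrightarrow> i \<in> I \<Longrightarrow> a i \<in> form (m i)"
    "\<And>i j x. i \<in> I \<Longrightarrow> j \<in> I \<Longrightarrow> P i j x = (\<Sum>a\<leftarrow>as. a i x * a j x)"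
  using assms unfolding sos_forms_def by blast

lemma sos_forms_add:
  assumes "sos_forms I m P" "sos_forms I m R"
  shows "sos_forms I m (\<lambda>i j x. P i j x + R i j x)"
proof -
  obtain as where as: "\<And>a i. a \<in> set as \<Longrightarrow> i \<in> I \<Longrightarrow> a i \<in> form (m i)"
    "\<And>i j x. i \<in> I \<Longrightarrow> j \<in> I \<Longrightarrow> P i j x = (\<Sum>a\<leftarrow>as. a i x * a j x)"
    using sos_formsE[OF assms(1)] by blast
  obtain bs where bs: "\<And>a i. a \<in> set bs \<Longrightarrow> i \<in> I \<Longrightarrow> a i \<in> form (m i)"
    "\<And>i j x. i \<in> I \<Longrightarrow> j \<in> I \<Longrightarrow> R i j x = (\<Sum>a\<leftarrow>bs. a i x * a j x)"
    using sos_formsE[OF assms(2)] by blast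
  show ?thesis
    by (rule sos_formsI[of "as @ bs"]) (auto simp: as bs)
qed

lemma sos_forms_cong:
  assumes "sos_forms I m R" "\<And>i j x. i \<in> I \<Longrightarrow> j \<in> I \<Longrightarrow> P i j x = R i j x"
  shows "sos_forms I m P"
proof -
  obtain as where "\<And>a i. a \<in> set as \<Longrightarrow> i \<in> I \<Longrightarrow> a i \<in> form (m i)"
    "\<And>i j x. i \<in> I \<Longrightarrow> j \<in> I \<Longrightarrow> R i j x = (\<Sum>a\<leftarrow>as. a i x * a j x)"
    using sos_formsE[OF assms(1)] by blast
  then show ?thesis
    using assms(2) by (intro sos_formsI[of as]) simp_all
qed

text \<open>
  The admissible entries in row \<open>i\<close> and column \<open>k\<close> of a change of basis between weights \<open>p = m i\<close>
  and \<open>q = m k\<close>: multiplication takes forms of degree \<open>q\<close> to forms of degree \<open>p\<close>. If \<open>p < q\<close>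
  only zero does that; the case distinction is needed because the truncated difference \<open>p - q\<close>
  would admit constants.
\<close>
definition shift_form :: "nat \<Rightarrow> nat \<Rightarrow> (real \<times> real \<Rightarrow> real) set" where
  "shift_form p q = (if q \<le> p then form (p - q) else {\<lambda>x. 0})"

lemma shift_form_zero: "(\<lambda>x. 0) \<in> shift_form p q"
  by (simp add: shift_form_def form_zero)

lemma shift_form_one: "(\<lambda>x. 1) \<in> shift_form p p"
  by (simp add: shift_form_def)

lemma shift_form_mult:
  assumes "s \<in> shift_form p q" "f \<in> form (q + r)"
  shows "(\<lambda>x. s x * f x) \<in> form (p + r)"
proof (cases "q \<le> p")
  case True
  then show ?thesis
    using assms form_mult[of s "p - q" f "q + r"] by (simp add: shift_form_def)
next
  case False
  then show ?thesis using assms by (auto simp: shift_form_def form_zero)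
qed

text \<open>
  A sum of squares stays one under a change of basis that respects the weights, since
  \<open>S (a a\<^sup>T) S\<^sup>T = (S a) (S a)\<^sup>T\<close>. The index set may change as well, which covers dropping a zero row.
\<close>
lemma sos_forms_congruence:
  assumes R: "sos_forms J m' R"
    and S: "\<And>i k. i \<in> I \<Longrightarrow> k \<in> J \<Longrightarrow> S i k \<in> shift_form (m i) (m' k)"
    and P: "\<And>i j x. i \<in> I \<Longrightarrow> j \<in> I \<Longrightarrow> P i j x = (\<Sum>k\<in>J. \<Sum>l\<in>J. S i k x * S j l x * R k l x)"
  shows "sos_forms I m P"
proof -
  obtain as where as: "\<And>a i. a \<in> set as \<Longrightarrow> i \<in> J \<Longrightarrow> a i \<in> form (m' i)"
    "\<And>i j x. i \<in> J \<Longrightarrow> j \<in> J \<Longrightarrow> R i j x = (\<Sum>a\<leftarrow>as. a i x * a j x)"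
    using sos_formsE[OF R] by blast
  define b where "b a i x = (\<Sum>k\<in>J. S i k x * a k x)" for a i x
  show ?thesis
  proof (rule sos_formsI[of "map b as"])
    fix a' i assume "a' \<in> set (map b as)" and i: "i \<in> I"
    then obtain a where a: "a \<in> set as" "a' = b a" by auto
    have "(\<lambda>x. S i k x * a k x) \<in> form (m i)" if "k \<in> J" for k
      using shift_form_mult[OF S[OF i that], of "a k" 0] as(1)[OF a(1) that] by simp
    then show "a' i \<in> form (m i)"
      unfolding a b_def[abs_def] by (rule form_sum)
  next
    fix i j x assume i: "i \<in> I" and j: "j \<in> I"
    have "P i j x = (\<Sum>k\<in>J. \<Sum>l\<in>J. \<Sum>a\<leftarrow>as. (S i k x * a k x) * (S j l x * a l x))"
      unfolding P[OF i j] by (intro sum.cong refl) (simp add: as(2) mult_ac flip: sum_list_const_mult)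
    also have "\<dots> = (\<Sum>a\<leftarrow>as. \<Sum>k\<in>J. \<Sum>l\<in>J. (S i k x * a k x) * (S j l x * a l x))"
      by (induction as) (simp_all add: sum.distrib)
    also have "\<dots> = (\<Sum>a\<leftarrow>map b as. a i x * a j x)"
      by (simp add: b_def sum_product comp_def)
    finally show "P i j x = (\<Sum>a\<leftarrow>map b as. a i x * a j x)" .
  qed
qed

text \<open>
  Multiplying a sum of squares by \<open>c\<^sup>2 + s\<^sup>2\<close> doubles the number of squares.
\<close>
lemma norm_sq_power_sos:
  "\<exists>bs. set bs \<subseteq> form k \<and> (\<forall>x. norm_sq x ^ k = (\<Sum>b\<leftarrow>bs. (b x)\<^sup>2))"
proof (induction k)
  case 0
  then show ?case by (intro exI[of _ "[\<lambda>x. 1]"]) auto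
next
  case (Suc k)
  then obtain bs where bs: "set bs \<subseteq> form k" "\<And>x. norm_sq x ^ k = (\<Sum>b\<leftarrow>bs. (b x)\<^sup>2)"
    by blast
  let ?cs = "map (\<lambda>b x. fst x * b x + snd x * 0) bs @ map (\<lambda>b x. fst x * 0 + snd x * b x) bs"
  have "set ?cs \<subseteq> form (Suc k)"
    using bs(1) form_SucI[OF _ form_zero] form_SucI[OF form_zero] by fastforce
  moreover have "norm_sq x ^ Suc k = (\<Sum>b\<leftarrow>?cs. (b x)\<^sup>2)" for x
    unfolding power_Suc bs(2) by (simp add: comp_def power_mult_distrib sum_list_const_mult norm_sq_def distrib_right)
  ultimately show ?case by blast
qed

lemma sos_forms_diagonal:
  assumes "finite K" "0 \<le> c"
  shows "sos_forms I m (\<lambda>i j x. if i = j \<and> i \<in> K then c * norm_sq x ^ m i else 0)"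
  using assms(1)
proof (induction K)
  case empty
  show ?case by (rule sos_formsI[of "[]"]) auto
next
  case (insert k K)
  obtain bs where bs: "set bs \<subseteq> form (m k)" "\<And>x. norm_sq x ^ m k = (\<Sum>b\<leftarrow>bs. (b x)\<^sup>2)"
    using norm_sq_power_sos by blast
  let ?as = "map (\<lambda>b i x. if i = k then sqrt c * b x else 0) bs"
  have "sos_forms I m (\<lambda>i j x. if i = j \<and> i = k then c * norm_sq x ^ m i else 0)"
  proof (rule sos_formsI[of ?as])
    fix a i assume "a \<in> set ?as" "i \<in> I"
    then show "a i \<in> form (m i)"
      using bs(1) form_zero[of "m i"] by (cases "i = k") (auto intro!: form_scale)
  next
    fix i j x
    have sq: "sqrt c * y * (sqrt c * y) = c * y\<^sup>2" for y
      using assms(2) by (simp add: power2_eq_square mult.left_commute mult.assoc flip: mult.assoc[of "sqrt c" "sqrt c"])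
    show "(if i = j \<and> i = k then c * norm_sq x ^ m i else 0) = (\<Sum>a\<leftarrow>?as. a i x * a j x)"
    proof (cases "i = j \<and> i = k")
      case True
      then show ?thesis by (simp add: comp_def bs(2) sum_list_const_mult sq)
    next
      case False
      have "(\<Sum>a\<leftarrow>?as. a i x * a j x) = (\<Sum>b\<leftarrow>bs. 0)"
        unfolding map_map comp_def by (rule arg_cong[where f = sum_list], rule map_cong) (use False in auto)
      also have "\<dots> = 0" by simp
      finally show ?thesis by (simp only: False if_False)
    qed
  qed
  from sos_forms_add[OF insert.IH this] show ?case
    by (rule back_subst[where P = "sos_forms I m"]) (use insert.hyps in \<open>auto simp: fun_eq_iff\<close>)
qed

lemma psd_forms_congruence:
  assumes P: "psd_forms I m P" 
    and T: "\<And>k i. k \<in> J \<Longrightarrow> i \<in> I \<Longrightarrow> T k i \<in> shift_form (m' k) (m i)"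
  shows "psd_forms J m' (\<lambda>k l x. \<Sum>i\<in>I. \<Sum>j\<in>I. T k i x * T l j x * P i j x)"
  unfolding psd_forms_def
proof (intro conjI ballI allI)
  fix k l assume k: "k \<in> J" and l: "l \<in> J"
  have "(\<lambda>x. T k i x * T l j x * P i j x) \<in> form (m' k + m' l)" if i: "i \<in> I" and j: "j \<in> I" for i j
  proof -
    have "P i j \<in> form (m j + m i)"
      using P i j by (simp add: psd_forms_def add.commute)
    from shift_form_mult[OF T[OF l j] this]
    have "(\<lambda>x. T l j x * P i j x) \<in> form (m i + m' l)" by (simp add: add.commute)
    from shift_form_mult[OF T[OF k i] this] show ?thesis by (simp add: mult.assoc)
  qed
  then show "(\<lambda>x. \<Sum>i\<in>I. \<Sum>j\<in>I. T k i x * T l j x * P i j x) \<in> form (m' k + m' l)"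
    by (intro form_sum)
  show "(\<lambda>x. \<Sum>i\<in>I. \<Sum>j\<in>I. T k i x * T l j x * P i j x) = (\<lambda>x. \<Sum>i\<in>I. \<Sum>j\<in>I. T l i x * T k j x * P i j x)"
  proof
    fix x
    have "(\<Sum>i\<in>I. \<Sum>j\<in>I. T k i x * T l j x * P i j x) = (\<Sum>j\<in>I. \<Sum>i\<in>I. T k i x * T l j x * P i j x)"
      by (rule sum.swap)
    also have "\<dots> = (\<Sum>i\<in>I. \<Sum>j\<in>I. T l i x * T k j x * P i j x)"
      using P by (intro sum.cong refl) (auto simp: psd_forms_def mult_ac)
    finally show "(\<Sum>i\<in>I. \<Sum>j\<in>I. T k i x * T l j x * P i j x) = (\<Sum>i\<in>I. \<Sum>j\<in>I. T l i x * T k j x * P i j x)" .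
  qed
next
  fix x z
  show "0 \<le> quad J (\<lambda>k l. \<Sum>i\<in>I. \<Sum>j\<in>I. T k i x * T l j x * P i j x) z"
    using P by (subst quad_congruence[where I=I and T="\<lambda>k i. T k i x" and A = "\<lambda>i j. P i j x"])
      (auto simp: psd_forms_def simp del: split_paired_All)
qed

text \<open>
  Off the line through \<open>u\<close> the quotient is a congruent matrix and so positive semidefinite; on the
  line this persists by continuity. The diagonal entry is divided twice, which lowers its
  degree by two and fits the new weight.
\<close>
lemma psd_forms_divide_row:
  assumes P: "psd_forms I m P" and I: "finite I" "k \<in> I" and u: "norm_sq u = 1"
    and zero: "\<And>j. j \<in> I \<Longrightarrow> P k j u = 0" and mk: "m k = Suc m'"
  shows "\<exists>R. psd_forms I (m(k := m')) R \<and> (\<forall>i\<in>I. \<forall>j\<in>I. \<forall>x.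
    P i j x = (if i = k then across u x else 1) * (if j = k then across u x else 1) * R i j x)"
proof -
  let ?d = "\<lambda>x i. if i = k then across u x else 1"
  have form: "P i j \<in> form (m i + m j)" and sym: "P i j = P j i" if "i \<in> I" "j \<in> I" for i j
    using P that by (auto simp: psd_forms_def)
  have psd: "0 \<le> quad I (\<lambda>i j. P i j x) z" for x z
    using P unfolding psd_forms_def by blast
  have diag: "0 \<le> P k k x" for x
    using quad_add_unit[where A = "\<lambda>i j. P i j x" and z = "\<lambda>i. 0" and e = 1, OF I] sym psd[of x "\<lambda>i. 0 + (if i = k then 1 else 0)"]
    by (simp add: quad_def)
  obtain g where g: "g \<in> form (m' + m')" "\<And>x. P k k x = (across u x)\<^sup>2 * g x"
    using nonneg_form_divide_across_sq[where f = "P k k" and k = "m' + m'", OF u _ diag zero[OF I(2)]]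
      form[OF I(2) I(2)] mk by auto
  have "\<exists>h. h \<in> form (m' + m j) \<and> (\<forall>x. P k j x = across u x * h x)" if j: "j \<in> I" for j
    using form_divide_across[where f = "P k j" and k = "m' + m j", OF u _ zero[OF j]] form[OF I(2) j] mk
    by (metis add_Suc)
  then obtain h where h: "\<And>j. j \<in> I \<Longrightarrow> h j \<in> form (m' + m j)"
    "\<And>j x. j \<in> I \<Longrightarrow> P k j x = across u x * h j x"
    by metis
  define R where "R i j = (if i = k then if j = k then g else h j else if j = k then h i else P i j)" for i j
  have PR: "P i j x = ?d x i * ?d x j * R i j x" if "i \<in> I" "j \<in> I" for i j x
    using that h(2)[of j x] h(2)[of i x] sym[of i j] g(2)[of x]
    by (auto simp: R_def power2_eq_square)
  have "psd_forms I (m(k := m')) R"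
    unfolding psd_forms_def
  proof (intro conjI ballI allI)
    fix i j assume ij: "i \<in> I" "j \<in> I"
    show Rf: "R i j \<in> form ((m(k := m')) i + (m(k := m')) j)"
      using ij form g(1) h(1) by (auto simp: R_def add.commute)
    show "R i j = R j i"
      using ij sym by (auto simp: R_def)
  next
    fix x z
    have "continuous_on UNIV (R i j)" if "i \<in> I" "j \<in> I" for i j
      using that form_continuous[OF g(1)] form_continuous[OF h(1)] form_continuous[OF form]
      by (auto simp: R_def)
    then have "continuous_on UNIV (\<lambda>x. quad I (\<lambda>i j. R i j x) z)"
      unfolding quad_def by (intro continuous_intros)
    moreover have "0 \<le> quad I (\<lambda>i j. R i j x) z" if "across u x \<noteq> 0" for x
    proof -
      have "quad I (\<lambda>i j. R i j x) z = quad I (\<lambda>i j. P i j x) (\<lambda>i. z i / ?d x i)"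
        unfolding quad_def using that PR by (intro sum.cong refl) auto
      then show ?thesis using psd by simp
    qed
    ultimately show "0 \<le> quad I (\<lambda>i j. R i j x) z"
      using nonneg_off_line[OF u] by blast
  qed
  then show ?thesis using PR by blast
qed

section \<open>Positive semidefinite matrices of forms are sums of squares\<close>

lemma scaled_unit:
  obtains r u where "norm_sq u = 1" "x = (r * fst u, r * snd u)" "norm_sq x = r\<^sup>2"
proof (cases "norm_sq x = 0")
  case True
  show ?thesis
  proof (rule that)
    show "norm_sq (1, 0) = 1" by (simp add: norm_sq_def)
    show "x = (0 * fst (1::real, 0::real), 0 * snd (1::real, 0::real))"
      using True by (simp add: norm_sq_def prod_eq_iff sum_power2_eq_zero_iff)
    show "norm_sq x = 0\<^sup>2" using True by simp
  qed
next
  case False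
  define r where "r = sqrt (norm_sq x)"
  have "0 \<le> norm_sq x" by (simp add: norm_sq_def)
  then have r: "r > 0" "r\<^sup>2 = norm_sq x" using False by (auto simp: r_def)
  show ?thesis
  proof (rule that)
    have "norm_sq (fst x / r, snd x / r) = norm_sq x / r\<^sup>2"
      by (simp add: norm_sq_def power_divide add_divide_distrib)
    then show "norm_sq (fst x / r, snd x / r) = 1" using False r(2) by simp
    show "x = (r * fst (fst x / r, snd x / r), r * snd (fst x / r, snd x / r))"
      using r(1) by simp
    show "norm_sq x = r\<^sup>2" using r(2) by simp
  qed
qed

text \<open>
  Here \<open>c\<close> is the minimum of the quadratic form over all unit points of the plane and all unit
  vectors. On the circle the subtracted matrix is \<open>c\<close> times the identity; off the circle,
  homogeneity turns the factors \<open>norm_sq x ^ m i\<close> into a rescaling of the vector.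
\<close>
lemma psd_forms_subtract_to_zero:
  assumes P: "psd_forms I m P" and I: "finite I" "I \<noteq> {}"
  obtains c u z k where "0 \<le> c" "norm_sq u = 1" "k \<in> I" "z k \<noteq> 0"
    "psd_forms I m (\<lambda>i j x. P i j x - (if i = j then c * norm_sq x ^ m i else 0))"
    "quad I (\<lambda>i j. P i j u - (if i = j then c * norm_sq u ^ m i else 0)) z = 0"
proof -
  have form: "P i j \<in> form (m i + m j)" and sym: "P i j = P j i" if "i \<in> I" "j \<in> I" for i j
    using P that by (auto simp: psd_forms_def)
  have P_psd: "0 \<le> quad I (\<lambda>i j. P i j x) w" for x w
    using P unfolding psd_forms_def by blast
  have cont: "continuous_on UNIV (P i j)" if "i \<in> I" "j \<in> I" for i j
    using form_continuous form that by blast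
  obtain u z where u: "norm_sq u = 1" and z: "(\<Sum>i\<in>I. (z i)\<^sup>2) = 1" and
    min: "\<forall>x w. norm_sq x = 1 \<longrightarrow>
      quad I (\<lambda>i j. P i j u) z * (\<Sum>i\<in>I. (w i)\<^sup>2) \<le> quad I (\<lambda>i j. P i j x) w"
    using quad_attains_min[where P = P, OF I] cont by blast
  define c where "c = quad I (\<lambda>i j. P i j u) z"
  define R where "R i j x = P i j x - (if i = j then c * norm_sq x ^ m i else 0)" for i j x
  have quad_R: "quad I (\<lambda>i j. R i j x) w =
      quad I (\<lambda>i j. P i j x) w - (\<Sum>i\<in>I. c * norm_sq x ^ m i * (w i)\<^sup>2)" for x w
  proof -
    have "(\<Sum>i\<in>I. \<Sum>j\<in>I. w i * w j * (if i = j then c * norm_sq x ^ m i else 0)) =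
        (\<Sum>i\<in>I. \<Sum>j\<in>I. if i = j then c * norm_sq x ^ m i * (w i)\<^sup>2 else 0)"
      by (intro sum.cong refl) (auto simp: power2_eq_square)
    also have "\<dots> = (\<Sum>i\<in>I. c * norm_sq x ^ m i * (w i)\<^sup>2)"
      using I(1) by (simp add: sum.delta')
    finally show ?thesis
      by (simp add: quad_def R_def right_diff_distrib sum_subtractf)
  qed
  have "psd_forms I m R"
    unfolding psd_forms_def
  proof (intro conjI ballI allI)
    fix i j assume ij: "i \<in> I" "j \<in> I"
    have "(\<lambda>x. c * norm_sq x ^ m i) \<in> form (m i + m i)"
      using form_scale[OF form_power[OF form_norm_sq, of "m i"], of c] by (simp add: mult_2)
    then show "R i j \<in> form (m i + m j)"
      using form_diff[OF form[OF ij], of "\<lambda>x. if i = j then c * norm_sq x ^ m i else 0"]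
        form_zero[of "m i + m j"]
      by (cases "i = j") (auto simp: R_def[abs_def])
    show "R i j = R j i"
      using sym[OF ij] by (auto simp: R_def)
  next
    fix x w
    obtain r v where v: "norm_sq v = 1" "x = (r * fst v, r * snd v)" "norm_sq x = r\<^sup>2"
      by (rule scaled_unit)
    have "(\<Sum>i\<in>I. c * norm_sq x ^ m i * (w i)\<^sup>2) = c * (\<Sum>i\<in>I. (r ^ m i * w i)\<^sup>2)"
      unfolding v(3) sum_distrib_left mult.assoc
      by (intro sum.cong refl) (simp add: power_mult_distrib power_mult[symmetric] mult.commute[of 2])
    also have "\<dots> \<le> quad I (\<lambda>i j. P i j v) (\<lambda>i. r ^ m i * w i)"
      unfolding c_def by (rule min[rule_format, OF v(1)])
    also have "\<dots> = quad I (\<lambda>i j. P i j x) w"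
      unfolding quad_def v(2)
      by (intro sum.cong refl) (simp add: form_homogeneous[OF form] power_add)
    finally show "0 \<le> quad I (\<lambda>i j. R i j x) w"
      by (simp add: quad_R)
  qed
  moreover have "quad I (\<lambda>i j. R i j u) z = 0"
    by (simp add: quad_R u z c_def flip: sum_distrib_left)
  moreover have "0 \<le> c"
    unfolding c_def by (rule P_psd)
  moreover obtain k where "k \<in> I" "z k \<noteq> 0"
  proof -
    have "(\<Sum>i\<in>I. (z i)\<^sup>2) = 0" if "\<forall>k\<in>I. z k = 0"
      using that by simp
    with z have "\<not> (\<forall>k\<in>I. z k = 0)" by (metis zero_neq_one)
    then show ?thesis using that by blast
  qed
  ultimately show ?thesis
    unfolding R_def by (intro that[where c = c and u = u and z = z] u)
qed

text \<open>
  The kernel vector \<open>z\<close> at \<open>u\<close> has to be extended to a vector \<open>v\<close> of forms, with entry \<open>i\<close> of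
  degree \<open>m k - m i\<close>, that replaces basis vector \<open>k\<close>. Powers of \<open>along u\<close>, which is \<open>1\<close> at \<open>u\<close>, supply
  these degrees; they are nonnegative on the support of \<open>z\<close> because \<open>k\<close> has maximal weight there.
  Since the entry of \<open>v\<close> at \<open>k\<close> itself is \<open>1\<close>, the change of basis is invertible over the forms.
\<close>
lemma psd_forms_clear_row:
  assumes P: "psd_forms I m P" and I: "finite I" "k \<in> I" and u: "norm_sq u = 1"
    and zero: "quad I (\<lambda>i j. P i j u) z = 0" and zk: "z k \<noteq> 0"
    and max: "\<And>i. i \<in> I \<Longrightarrow> z i \<noteq> 0 \<Longrightarrow> m i \<le> m k"
  shows "\<exists>R S. psd_forms I m R \<and> (\<forall>j\<in>I. R k j u = 0) \<and>
    (\<forall>i\<in>I. \<forall>a\<in>I. S i a \<in> shift_form (m i) (m a)) \<and>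
    (\<forall>i\<in>I. \<forall>j\<in>I. \<forall>x. P i j x = (\<Sum>a\<in>I. \<Sum>b\<in>I. S i a x * S j b x * R a b x))"
proof -
  \<comment> \<open>Row \<open>k\<close> of \<open>T\<close> is \<open>v\<close>, all other rows are those of the identity; \<open>S\<close> is its inverse.\<close>
  define v where "v i x = z i / z k * along u x ^ (m k - m i)" for i x
  define T where "T i a x = (if i = k then v a x else if a = i then 1 else 0)" for i a x
  define S where "S i a x = (if i = k \<and> a \<noteq> k then - v a x else if a = i then 1 else 0)" for i a x
  define R where "R i j x = (\<Sum>a\<in>I. \<Sum>b\<in>I. T i a x * T j b x * P a b x)" for i j x
  have v_shift: "(\<lambda>x. e * v i x) \<in> shift_form (m k) (m i)" if "i \<in> I" for i e
  proof (cases "z i = 0")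
    case True
    then show ?thesis by (simp add: v_def shift_form_zero)
  next
    case False
    then show ?thesis
      using max[OF that] form_scale[OF form_power[OF form_along[of u], of "m k - m i"], of "e * (z i / z k)"]
      by (simp add: v_def shift_form_def mult.assoc)
  qed
  have T_shift: "T i a \<in> shift_form (m i) (m a)" if "i \<in> I" "a \<in> I" for i a
    using v_shift[of a 1] that shift_form_zero shift_form_one
    by (cases "i = k"; cases "a = i") (auto simp: T_def[abs_def])
  have S_shift: "S i a \<in> shift_form (m i) (m a)" if "i \<in> I" "a \<in> I" for i a
    using v_shift[of a "-1"] that shift_form_zero shift_form_one
    by (cases "i = k"; cases "a = i") (auto simp: S_def[abs_def])
  have "v k x = 1" for x
    using zk by (simp add: v_def)
  have ST: "(\<Sum>a\<in>I. S i a x * T a b x) = (if b = i then 1 else 0)" if i: "i \<in> I" "b \<in> I" for i b x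
  proof (cases "i = k")
    case False
    then have "(\<Sum>a\<in>I. S i a x * T a b x) = (\<Sum>a\<in>I. if a = i then T i b x else 0)"
      by (intro sum.cong) (auto simp: S_def)
    then show ?thesis using i I False by (simp add: sum.delta T_def)
  next
    case True
    have "(\<Sum>a\<in>I. S i a x * T a b x) = S k k x * T k b x + (\<Sum>a\<in>I - {k}. S k a x * T a b x)"
      using I True by (simp add: sum.remove)
    also have "(\<Sum>a\<in>I - {k}. S k a x * T a b x) = (\<Sum>a\<in>I - {k}. if a = b then - v b x else 0)"
      by (intro sum.cong) (auto simp: S_def T_def)
    also have "\<dots> = (if b = k then 0 else - v b x)"
      using i I by (simp add: sum.delta)
    finally show ?thesis using True \<open>v k x = 1\<close> by (simp add: S_def T_def)
  qed
  have "psd_forms I m R"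
    unfolding R_def[abs_def] by (rule psd_forms_congruence[OF P T_shift])
  moreover have "R k j u = 0" if j: "j \<in> I" for j
  proof -
    have "along u u = 1"
      using u by (simp add: along_def norm_sq_def power2_eq_square)
    have "(\<Sum>a\<in>I. v a u * P a b u) = 0" if b: "b \<in> I" for b
    proof -
      have "(\<Sum>a\<in>I. P b a u * z a) = 0"
        using P by (intro psd_isotropic_in_kernel[OF I(1) b _ _ zero])
          (auto simp: psd_forms_def simp del: split_paired_All)
      moreover have "v a u * P a b u = P b a u * z a / z k" if "a \<in> I" for a
        using that b P by (auto simp: psd_forms_def v_def \<open>along u u = 1\<close>)
      ultimately show ?thesis by (simp flip: sum_divide_distrib)
    qed
    moreover have "R k j u = (\<Sum>b\<in>I. T j b u * (\<Sum>a\<in>I. v a u * P a b u))"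
      unfolding R_def by (subst sum.swap) (simp add: T_def[of k] sum_distrib_left mult_ac)
    ultimately show ?thesis by simp
  qed
  moreover have "P i j x = (\<Sum>a\<in>I. \<Sum>b\<in>I. S i a x * S j b x * R a b x)" if "i \<in> I" "j \<in> I" for i j x
    by (rule congruence_inverse[OF I(1) R_def ST that])
  ultimately show ?thesis
    using S_shift by blast
qed

lemma sum_sum_delta:
  fixes A :: "'i \<Rightarrow> 'i \<Rightarrow> real"
  assumes "finite J"
  shows "(\<Sum>a\<in>J. \<Sum>b\<in>J. (if a = i then p else 0) * (if b = j then q else 0) * A a b) =
    (if i \<in> J \<and> j \<in> J then p * q * A i j else 0)"
proof -
  have "(\<Sum>b\<in>J. (if a = i then p else 0) * (if b = j then q else 0) * A a b) =
      (if a = i then if j \<in> J then p * q * A i j else 0 else 0)" for a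
  proof -
    have "(\<Sum>b\<in>J. (if a = i then p else 0) * (if b = j then q else 0) * A a b) =
        (\<Sum>b\<in>J. if b = j then (if a = i then p else 0) * q * A a j else 0)"
      by (intro sum.cong refl) simp
    then show ?thesis using assms by (simp add: sum.delta)
  qed
  then show ?thesis using assms by (simp add: sum.delta)
qed

text \<open>
  Each round lowers one weight or removes one index, so the sum of \<open>m i + 1\<close> over all indices
  decreases.
\<close>
lemma psd_forms_imp_sos_forms:
  assumes "finite I" "psd_forms I m P"
  shows "sos_forms I m P"
  using assms
proof (induction "\<Sum>i\<in>I. Suc (m i)" arbitrary: I m P rule: less_induct)
  case less
  note P = less.prems(2)
  show ?case
  proof (cases "I = {}")
    case True
    then show ?thesis by (intro sos_formsI[of "[]"]) auto
  next
    case False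
    obtain c u z k0 where c: "0 \<le> c" and u: "norm_sq u = 1" and k0: "k0 \<in> I" "z k0 \<noteq> 0" and
      P': "psd_forms I m (\<lambda>i j x. P i j x - (if i = j then c * norm_sq x ^ m i else 0))" and
      zero: "quad I (\<lambda>i j. P i j u - (if i = j then c * norm_sq u ^ m i else 0)) z = 0"
      by (rule psd_forms_subtract_to_zero[OF P less.prems(1) False]; rule that; assumption)
    let ?P' = "\<lambda>i j x. P i j x - (if i = j then c * norm_sq x ^ m i else 0)"
    define K where "K = {i \<in> I. z i \<noteq> 0}"
    have K: "finite (m ` K)" "m ` K \<noteq> {}"
      using k0 less.prems(1) by (auto simp: K_def)
    from Max_in[OF K] obtain k where "k \<in> K" "m k = Max (m ` K)"
      by (metis imageE)
    then have k: "k \<in> I" "z k \<noteq> 0" "\<And>i. i \<in> I \<Longrightarrow> z i \<noteq> 0 \<Longrightarrow> m i \<le> m k"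
      using Max_ge[OF K(1)] by (simp_all add: K_def)
    obtain R S where R: "psd_forms I m R" "\<forall>j\<in>I. R k j u = 0" and
      S: "\<forall>i\<in>I. \<forall>a\<in>I. S i a \<in> shift_form (m i) (m a)"
      "\<forall>i\<in>I. \<forall>j\<in>I. \<forall>x. ?P' i j x = (\<Sum>a\<in>I. \<Sum>b\<in>I. S i a x * S j b x * R a b x)"
      using psd_forms_clear_row[OF P' less.prems(1) k(1) u zero k(2)] k(3) by blast
    have R_form: "R i j \<in> form (m i + m j)" and R_sym: "R i j = R j i" if "i \<in> I" "j \<in> I" for i j
      using R(1) that by (auto simp: psd_forms_def)
    have R_psd: "0 \<le> quad I (\<lambda>i j. R i j x) z" for x z
      using R(1) unfolding psd_forms_def by blast
    have "sos_forms I m R"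
    proof (cases "m k")
      case 0
      have "R k k x = 0" for x
        using R_form[OF k(1) k(1)] R(2)[rule_format, OF k(1)] 0 by auto
      have "R k j x = 0" if "j \<in> I" for j x
        by (rule psd_zero_diagonal_zero_row[where A = "\<lambda>i j. R i j x", OF less.prems(1) k(1) that])
           (simp_all add: R_psd \<open>R k k x = 0\<close> R_sym)
      then have row: "R k j x = 0" "R j k x = 0" if "j \<in> I" for j x
        using R_sym[OF that k(1)] that by simp_all
      let ?J = "I - {k}"
      have split: "(\<Sum>i\<in>I. f i) = f k + (\<Sum>i\<in>?J. f i)" for f :: "_ \<Rightarrow> real"
        using less.prems(1) k(1) by (simp add: sum.remove)
      have "quad ?J (\<lambda>i j. R i j x) w = quad I (\<lambda>i j. R i j x) w" for x w
        unfolding quad_def split using row k(1) by simp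
      then have "psd_forms ?J m R"
        using R_form R_sym R_psd by (simp add: psd_forms_def)
      moreover have "(\<Sum>i\<in>?J. Suc (m i)) < (\<Sum>i\<in>I. Suc (m i))"
        using less.prems(1) k(1) by (simp add: sum.remove[of I k])
      ultimately have "sos_forms ?J m R"
        using less.hyps less.prems(1) by simp
      then show ?thesis
      proof (rule sos_forms_congruence[where S = "\<lambda>i a x. if a = i then 1 else 0"])
        fix i a assume "i \<in> I" "a \<in> ?J"
        then show "(\<lambda>x. if a = i then 1 else 0) \<in> shift_form (m i) (m a)"
          using shift_form_zero shift_form_one by auto
      next
        fix i j x assume ij: "i \<in> I" "j \<in> I"
        show "R i j x =
            (\<Sum>a\<in>?J. \<Sum>b\<in>?J. (if a = i then 1 else 0) * (if b = j then 1 else 0) * R a b x)"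
          using ij less.prems(1) row by (auto simp: sum_sum_delta)
      qed
    next
      case (Suc m')
      let ?d = "\<lambda>i x. if i = k then across u x else 1"
      obtain G where G: "psd_forms I (m(k := m')) G"
        "\<forall>i\<in>I. \<forall>j\<in>I. \<forall>x. R i j x = ?d i x * ?d j x * G i j x"
        using psd_forms_divide_row[where P = R, OF R(1) less.prems(1) k(1) u _ Suc] R(2) by blast
      have "(\<Sum>i\<in>I. Suc ((m(k := m')) i)) < (\<Sum>i\<in>I. Suc (m i))"
        using less.prems(1) k(1) Suc by (intro sum_strict_mono_ex1) auto
      then have "sos_forms I (m(k := m')) G"
        using less.hyps less.prems(1) G(1) by blast
      then show ?thesis
      proof (rule sos_forms_congruence[where S = "\<lambda>i a x. if a = i then ?d i x else 0"])
        fix i a assume "i \<in> I" "a \<in> I"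
        then show "(\<lambda>x. if a = i then ?d i x else 0) \<in> shift_form (m i) ((m(k := m')) a)"
        proof (cases "a = i")
          case True
          have "across u \<in> shift_form (m k) m'"
            using form_across[of u] Suc by (simp add: shift_form_def del: form.simps)
          then show ?thesis
            using True shift_form_one by (cases "i = k") simp_all
        qed (simp add: shift_form_zero)
      next
        fix i j x assume ij: "i \<in> I" "j \<in> I"
        show "R i j x =
            (\<Sum>a\<in>I. \<Sum>b\<in>I. (if a = i then ?d i x else 0) * (if b = j then ?d j x else 0) * G a b x)"
          using ij less.prems(1) G(2) by (simp only: sum_sum_delta) simp
      qed
    qed
    then have "sos_forms I m ?P'"
      by (rule sos_forms_congruence[OF _ S[rule_format]])
    from sos_forms_add[OF this sos_forms_diagonal[OF less.prems(1) c, of I m]]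
    show ?thesis
      by (rule sos_forms_cong) simp
  qed
qed

section \<open>From the circle to the interval\<close>

text \<open>
  Polynomials of degree less than \<open>k\<close>. Unlike a bound on the degree, this makes sense for
  \<open>k = 0\<close>, where only the zero polynomial is left; this is the case of the second weight for
  constant matrices.
\<close>
definition poly_lt :: "nat \<Rightarrow> real poly set" where
  "poly_lt k = {p. \<forall>j\<ge>k. coeff p j = 0}"

hide_const (open) Module.smult

lemma poly_lt_add: "p \<in> poly_lt k \<Longrightarrow> q \<in> poly_lt k \<Longrightarrow> p + q \<in> poly_lt k"
  by (simp add: poly_lt_def)

lemma poly_lt_smult: "p \<in> poly_lt k \<Longrightarrow> smult c p \<in> poly_lt k"
  by (simp add: poly_lt_def)

lemma poly_lt_linear_mult: "p \<in> poly_lt k \<Longrightarrow> [:a, b:] * p \<in> poly_lt (Suc k)"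
  by (auto simp: poly_lt_def coeff_pCons split: nat.split)

lemma poly_eq_sum_lt:
  assumes "p \<in> poly_lt k"
  shows "poly p t = (\<Sum>r<k. coeff p r * t ^ r)"
proof -
  have "(\<Sum>r\<le>degree p. coeff p r * t ^ r) = (\<Sum>r\<in>{..<k} \<union> {..degree p}. coeff p r * t ^ r)"
    by (rule sum.mono_neutral_left) (auto simp: coeff_eq_0)
  also have "\<dots> = (\<Sum>r<k. coeff p r * t ^ r)"
    using assms by (intro sum.mono_neutral_right) (auto simp: poly_lt_def)
  finally show ?thesis by (simp add: poly_altdef)
qed

text \<open>
  On the unit circle this is the cosine of the double angle, the substitution for \<open>t\<close>.
\<close>
definition cos2 :: "real \<times> real \<Rightarrow> real" where
  "cos2 x = (fst x)\<^sup>2 - (snd x)\<^sup>2"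

lemma fst_sq_circle: "norm_sq x = 1 \<Longrightarrow> fst x * fst x = poly [:1/2, 1/2:] (cos2 x)"
  by (simp add: norm_sq_def cos2_def power2_eq_square field_simps)

lemma snd_sq_circle: "norm_sq x = 1 \<Longrightarrow> snd x * snd x = poly [:1/2, -1/2:] (cos2 x)"
  by (simp add: norm_sq_def cos2_def power2_eq_square field_simps)

text \<open>
  One of the two inductive steps, separate because it also yields the odd case of the
  splitting. A product \<open>c \<cdot> c s q\<close> or \<open>s \<cdot> c s q\<close> contains a square of a coordinate, which is a linear
  polynomial in \<open>t\<close>.
\<close>
lemma odd_split_from_even:
  assumes even: "\<And>f. f \<in> form (2 * m) \<Longrightarrow> \<exists>p \<in> poly_lt (Suc m). \<exists>q \<in> poly_lt m. \<forall>x. norm_sq x = 1 \<longrightarrow>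
     f x = poly p (cos2 x) + fst x * snd x * poly q (cos2 x)"
    and f: "f \<in> form (Suc (2 * m))"
  shows "\<exists>p \<in> poly_lt (Suc m). \<exists>q \<in> poly_lt (Suc m). \<forall>x. norm_sq x = 1 \<longrightarrow>
     f x = fst x * poly p (cos2 x) + snd x * poly q (cos2 x)"
proof -
  obtain g h where gh: "g \<in> form (2 * m)" "h \<in> form (2 * m)" "\<And>x. f x = fst x * g x + snd x * h x"
    using form_SucE[OF f] by blast
  obtain p q where pq: "p \<in> poly_lt (Suc m)" "q \<in> poly_lt m"
    and g: "\<And>x. norm_sq x = 1 \<Longrightarrow> g x = poly p (cos2 x) + fst x * snd x * poly q (cos2 x)"
    using even[OF gh(1)] by blast
  obtain p' q' where pq': "p' \<in> poly_lt (Suc m)" "q' \<in> poly_lt m"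
    and h: "\<And>x. norm_sq x = 1 \<Longrightarrow> h x = poly p' (cos2 x) + fst x * snd x * poly q' (cos2 x)"
    using even[OF gh(2)] by blast
  have "f x = fst x * poly (p + [:1/2, -1/2:] * q') (cos2 x) + snd x * poly (p' + [:1/2, 1/2:] * q) (cos2 x)"
    if "norm_sq x = 1" for x
    unfolding gh(3) g[OF that] h[OF that] poly_add poly_mult fst_sq_circle[OF that, symmetric]
      snd_sq_circle[OF that, symmetric]
    by (simp add: algebra_simps)
  moreover have "p + [:1/2, -1/2:] * q' \<in> poly_lt (Suc m)" "p' + [:1/2, 1/2:] * q \<in> poly_lt (Suc m)"
    by (rule poly_lt_add[OF pq(1) poly_lt_linear_mult[OF pq'(2)]],
        rule poly_lt_add[OF pq'(1) poly_lt_linear_mult[OF pq(2)]])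
  ultimately show ?thesis by blast
qed

lemma form_split_even:
  "f \<in> form (2 * m) \<Longrightarrow> \<exists>p \<in> poly_lt (Suc m). \<exists>q \<in> poly_lt m. \<forall>x. norm_sq x = 1 \<longrightarrow>
     f x = poly p (cos2 x) + fst x * snd x * poly q (cos2 x)"
proof (induction m arbitrary: f)
  case 0
  then obtain a where "f = (\<lambda>x. a)" by auto
  then show ?case
    by (intro bexI[of _ "[:a:]"] bexI[of _ 0]) (auto simp: poly_lt_def coeff_pCons split: nat.split)
next
  case (Suc m)
  have "f \<in> form (Suc (Suc (2 * m)))" using Suc.prems by simp
  then obtain g h where gh: "g \<in> form (Suc (2 * m))" "h \<in> form (Suc (2 * m))"
    "\<And>x. f x = fst x * g x + snd x * h x"
    using form_SucE by blast
  obtain p q where pq: "p \<in> poly_lt (Suc m)" "q \<in> poly_lt (Suc m)"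
    and g: "\<And>x. norm_sq x = 1 \<Longrightarrow> g x = fst x * poly p (cos2 x) + snd x * poly q (cos2 x)"
    using odd_split_from_even[OF Suc.IH gh(1)] by blast
  obtain p' q' where pq': "p' \<in> poly_lt (Suc m)" "q' \<in> poly_lt (Suc m)"
    and h: "\<And>x. norm_sq x = 1 \<Longrightarrow> h x = fst x * poly p' (cos2 x) + snd x * poly q' (cos2 x)"
    using odd_split_from_even[OF Suc.IH gh(2)] by blast
  have "f x = poly ([:1/2, 1/2:] * p + [:1/2, -1/2:] * q') (cos2 x) + fst x * snd x * poly (q + p') (cos2 x)"
    if "norm_sq x = 1" for x
    unfolding gh(3) g[OF that] h[OF that] poly_add poly_mult fst_sq_circle[OF that, symmetric]
      snd_sq_circle[OF that, symmetric]
    by (simp add: algebra_simps)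
  moreover have "[:1/2, 1/2:] * p + [:1/2, -1/2:] * q' \<in> poly_lt (Suc (Suc m))" "q + p' \<in> poly_lt (Suc m)"
    by (rule poly_lt_add[OF poly_lt_linear_mult[OF pq(1)] poly_lt_linear_mult[OF pq'(2)]],
        rule poly_lt_add[OF pq(2) pq'(1)])
  ultimately show ?case by blast
qed

lemmas form_split_odd = odd_split_from_even[OF form_split_even]

text \<open>
  The form of degree \<open>2 d\<close> that restricts to \<open>p(c\<^sup>2 - s\<^sup>2)\<close> on the circle, for \<open>p\<close> of degree at most \<open>d\<close>.
\<close>
definition homogenize :: "nat \<Rightarrow> real poly \<Rightarrow> real \<times> real \<Rightarrow> real" where
  "homogenize d p x = (\<Sum>k<Suc d. coeff p k * (cos2 x ^ k * norm_sq x ^ (d - k)))"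

lemma form_cos2: "cos2 \<in> form 2"
  using form_quadratic[of 1 "-1"] by (simp add: cos2_def[abs_def])

lemma form_homogenize: "homogenize d p \<in> form (d + d)"
  unfolding homogenize_def[abs_def]
proof (intro form_sum form_scale)
  fix k assume "k \<in> {..<Suc d}"
  then have "2 * k + 2 * (d - k) = d + d" by auto
  then show "(\<lambda>x. cos2 x ^ k * norm_sq x ^ (d - k)) \<in> form (d + d)"
    using form_mult[OF form_power[OF form_cos2, of k] form_power[OF form_norm_sq, of "d - k"]] by simp
qed

lemma homogenize_eq:
  assumes "p \<in> poly_lt (Suc d)" "norm_sq x \<noteq> 0"
  shows "homogenize d p x = norm_sq x ^ d * poly p (cos2 x / norm_sq x)"
  unfolding homogenize_def poly_eq_sum_lt[OF assms(1)] sum_distrib_left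
proof (intro sum.cong refl)
  fix k assume "k \<in> {..<Suc d}"
  then have "norm_sq x ^ d = norm_sq x ^ k * norm_sq x ^ (d - k)"
    by (simp flip: power_add)
  then show "coeff p k * (cos2 x ^ k * norm_sq x ^ (d - k)) =
      norm_sq x ^ d * (coeff p k * (cos2 x / norm_sq x) ^ k)"
    using assms(2) by (simp add: power_divide)
qed

lemma homogenize_origin:
  assumes "norm_sq x = 0"
  shows "homogenize d p x = (if d = 0 then poly p 0 else 0)"
proof -
  have "cos2 x = 0"
    using assms by (simp add: norm_sq_def cos2_def sum_power2_eq_zero_iff)
  then have "homogenize d p x = (\<Sum>k<Suc d. if d = 0 then coeff p 0 else 0)"
    unfolding homogenize_def using assms by (intro sum.cong refl) (auto simp: power_0_left)
  then show ?thesis by (simp add: poly_0_coeff_0)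
qed

lemma psd_forms_homogenize:
  fixes P :: "nat \<Rightarrow> nat \<Rightarrow> real poly"
  assumes deg: "\<And>i j. i < n \<Longrightarrow> j < n \<Longrightarrow> P i j \<in> poly_lt (Suc d)"
    and sym: "\<And>i j. i < n \<Longrightarrow> j < n \<Longrightarrow> P i j = P j i"
    and psd: "\<And>t z. -1 \<le> t \<Longrightarrow> t \<le> 1 \<Longrightarrow> 0 \<le> quad {..<n} (\<lambda>i j. poly (P i j) t) z"
  shows "psd_forms {..<n} (\<lambda>i. d) (\<lambda>i j. homogenize d (P i j))"
  unfolding psd_forms_def
proof (intro conjI ballI allI)
  fix x z
  show "0 \<le> quad {..<n} (\<lambda>i j. homogenize d (P i j) x) z"
  proof (cases "norm_sq x = 0")
    case True
    then show ?thesis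
      using psd[of 0 z] by (cases "d = 0") (simp_all add: homogenize_origin quad_def)
  next
    case False
    moreover have "0 \<le> norm_sq x" by (simp add: norm_sq_def)
    ultimately have pos: "0 < norm_sq x" by simp
    have "quad {..<n} (\<lambda>i j. homogenize d (P i j) x) z =
        norm_sq x ^ d * quad {..<n} (\<lambda>i j. poly (P i j) (cos2 x / norm_sq x)) z"
      unfolding quad_def sum_distrib_left
      using False by (intro sum.cong refl) (simp add: homogenize_eq[OF deg])
    moreover have "- 1 \<le> cos2 x / norm_sq x" "cos2 x / norm_sq x \<le> 1"
      using pos by (simp_all add: field_simps) (simp_all add: norm_sq_def cos2_def)
    ultimately show ?thesis
      using psd pos by simp
  qed
qed (use form_homogenize sym in auto)

lemma circle_point:
  assumes "-1 \<le> t" "t \<le> 1"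
  obtains c s where "c\<^sup>2 = (1 + t) / 2" "s\<^sup>2 = (1 - t) / 2"
    "norm_sq (c, s) = 1" "cos2 (c, s) = t" "norm_sq (c, - s) = 1" "cos2 (c, - s) = t"
proof
  show "(sqrt ((1 + t) / 2))\<^sup>2 = (1 + t) / 2" "(sqrt ((1 - t) / 2))\<^sup>2 = (1 - t) / 2"
    using assms by simp_all
  then show "norm_sq (sqrt ((1 + t) / 2), sqrt ((1 - t) / 2)) = 1"
    "cos2 (sqrt ((1 + t) / 2), sqrt ((1 - t) / 2)) = t"
    "norm_sq (sqrt ((1 + t) / 2), - sqrt ((1 - t) / 2)) = 1"
    "cos2 (sqrt ((1 + t) / 2), - sqrt ((1 - t) / 2)) = t"
    by (simp_all add: norm_sq_def cos2_def field_simps)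
qed

lemma poly_eq_on_interval:
  fixes p q :: "real poly"
  assumes "\<And>t. -1 \<le> t \<Longrightarrow> t \<le> 1 \<Longrightarrow> poly p t = poly q t"
  shows "p = q"
proof (rule ccontr)
  assume "p \<noteq> q"
  then have "finite {t. poly (p - q) t = 0}"
    by (intro poly_roots_finite) simp
  moreover have "{-1..1} \<subseteq> {t. poly (p - q) t = 0}"
    using assms by auto
  ultimately have "finite {-1..1::real}"
    by (rule rev_finite_subset)
  moreover have "infinite {-1..1::real}"
    by (rule infinite_Icc) simp
  ultimately show False by blast
qed

lemma sum_list_scaled_products:
  fixes q :: "'a \<Rightarrow> 'i \<Rightarrow> real poly"
  shows "(\<Sum>b\<leftarrow>map (\<lambda>a i. smult c (q a i)) as. b i * b j) = smult (c * c) (\<Sum>a\<leftarrow>as. q a i * q a j)"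
  by (induction as) (simp_all add: smult_add_right)

lemma poly_sum_list: "poly (\<Sum>a\<leftarrow>as. f a) t = (\<Sum>a\<leftarrow>as. poly (f a) t)"
  by (induction as) simp_all

context
  fixes P :: "nat \<Rightarrow> nat \<Rightarrow> real poly" and n d :: nat
  assumes deg: "\<And>i j. i < n \<Longrightarrow> j < n \<Longrightarrow> P i j \<in> poly_lt (Suc d)"
    and sym: "\<And>i j. i < n \<Longrightarrow> j < n \<Longrightarrow> P i j = P j i"
    and psd: "\<And>t z. -1 \<le> t \<Longrightarrow> t \<le> 1 \<Longrightarrow> 0 \<le> quad {..<n} (\<lambda>i j. poly (P i j) t) z"
begin

lemma sos_on_circle:
  obtains as where "\<And>a i. a \<in> set as \<Longrightarrow> i < n \<Longrightarrow> a i \<in> form d"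
    "\<And>i j x. i < n \<Longrightarrow> j < n \<Longrightarrow> norm_sq x = 1 \<Longrightarrow> poly (P i j) (cos2 x) = (\<Sum>a\<leftarrow>as. a i x * a j x)"
proof -
  have "sos_forms {..<n} (\<lambda>i. d) (\<lambda>i j. homogenize d (P i j))"
    by (intro psd_forms_imp_sos_forms psd_forms_homogenize finite_lessThan deg sym psd)
  then obtain as where as: "\<And>a i. a \<in> set as \<Longrightarrow> i \<in> {..<n} \<Longrightarrow> a i \<in> form d"
    "\<And>i j x. i \<in> {..<n} \<Longrightarrow> j \<in> {..<n} \<Longrightarrow> homogenize d (P i j) x = (\<Sum>a\<leftarrow>as. a i x * a j x)"
    by (rule sos_formsE) blast
  have "poly (P i j) (cos2 x) = (\<Sum>a\<leftarrow>as. a i x * a j x)"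
    if "i < n" "j < n" "norm_sq x = 1" for i j x
    using homogenize_eq[OF deg[OF that(1,2)], of x] as(2)[of i j x] that by simp
  then show ?thesis using that[of as] as(1) by blast
qed

text \<open>
  The points \<open>(c, s)\<close> and \<open>(c, -s)\<close> belong to the same \<open>t\<close>; in the average of the two
  representations the products with a single factor \<open>c s\<close> cancel. The identity so obtained
  on the interval is one of polynomials. The factor \<open>1/2\<close> absorbs the denominator in
  \<open>c\<^sup>2 s\<^sup>2 = (1 - t\<^sup>2) / 4\<close>.
\<close>
lemma interval_sos_even:
  assumes d: "d = 2 * m"
  shows "\<exists>ps qs. (\<forall>p\<in>set ps. \<forall>i<n. p i \<in> poly_lt (Suc m)) \<and> (\<forall>q\<in>set qs. \<forall>i<n. q i \<in> poly_lt m) \<and>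
    (\<forall>i<n. \<forall>j<n. P i j = (\<Sum>p\<leftarrow>ps. p i * p j) + [:1, 0, -1:] * (\<Sum>q\<leftarrow>qs. q i * q j))"
proof -
  obtain as where as: "\<And>a i. a \<in> set as \<Longrightarrow> i < n \<Longrightarrow> a i \<in> form d"
    "\<And>i j x. i < n \<Longrightarrow> j < n \<Longrightarrow> norm_sq x = 1 \<Longrightarrow> poly (P i j) (cos2 x) = (\<Sum>a\<leftarrow>as. a i x * a j x)"
    using sos_on_circle by blast
  have "\<forall>a i. \<exists>p q. a \<in> set as \<and> i < n \<longrightarrow> p \<in> poly_lt (Suc m) \<and> q \<in> poly_lt m \<and>
      (\<forall>x. norm_sq x = 1 \<longrightarrow> a i x = poly p (cos2 x) + fst x * snd x * poly q (cos2 x))"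
    using form_split_even as(1) unfolding d by meson
  then obtain p q where pq: "\<And>a i. a \<in> set as \<Longrightarrow> i < n \<Longrightarrow> p a i \<in> poly_lt (Suc m) \<and> q a i \<in> poly_lt m"
    and a_eq: "\<And>a i x. a \<in> set as \<Longrightarrow> i < n \<Longrightarrow> norm_sq x = 1 \<Longrightarrow>
      a i x = poly (p a i) (cos2 x) + fst x * snd x * poly (q a i) (cos2 x)"
    by metis
  let ?ps = "map p as" and ?qs = "map (\<lambda>a i. smult (1/2) (q a i)) as"
  have "P i j = (\<Sum>p\<leftarrow>?ps. p i * p j) + [:1, 0, -1:] * (\<Sum>q\<leftarrow>?qs. q i * q j)" if ij: "i < n" "j < n" for i j
  proof (rule poly_eq_on_interval)
    fix t :: real assume "-1 \<le> t" "t \<le> 1"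
    then obtain c s where cs: "c\<^sup>2 = (1 + t) / 2" "s\<^sup>2 = (1 - t) / 2"
      "norm_sq (c, s) = 1" "cos2 (c, s) = t" "norm_sq (c, - s) = 1" "cos2 (c, - s) = t"
      by (rule circle_point)
    have "2 * poly (P i j) t = (\<Sum>a\<leftarrow>as. a i (c, s) * a j (c, s)) + (\<Sum>a\<leftarrow>as. a i (c, -s) * a j (c, -s))"
      using as(2)[OF ij cs(3)] as(2)[OF ij cs(5)] by (simp add: cs)
    also have "\<dots> = (\<Sum>a\<leftarrow>as. a i (c, s) * a j (c, s) + a i (c, -s) * a j (c, -s))"
      by (simp add: sum_list_addf)
    also have "\<dots> = (\<Sum>a\<leftarrow>as. 2 * poly (p a i * p a j) t + 2 * (c\<^sup>2 * s\<^sup>2) * poly (q a i * q a j) t)"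
    proof (intro arg_cong[where f = sum_list] map_cong refl)
      fix a assume a: "a \<in> set as"
      show "a i (c, s) * a j (c, s) + a i (c, -s) * a j (c, -s) = 2 * poly (p a i * p a j) t + 2 * (c\<^sup>2 * s\<^sup>2) * poly (q a i * q a j) t"
        unfolding a_eq[OF a ij(1) cs(3)] a_eq[OF a ij(2) cs(3)] a_eq[OF a ij(1) cs(5)] a_eq[OF a ij(2) cs(5)]
        by (simp add: cs(4,6) power2_eq_square algebra_simps)
    qed
    also have "\<dots> = 2 * (\<Sum>a\<leftarrow>as. poly (p a i * p a j) t) + 2 * (c\<^sup>2 * s\<^sup>2) * (\<Sum>a\<leftarrow>as. poly (q a i * q a j) t)"
      by (simp only: sum_list_addf sum_list_const_mult)
    also have "2 * (c\<^sup>2 * s\<^sup>2) = 2 * ((1 - t * t) * (1/4))"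
      unfolding cs(1,2) by (simp add: field_simps)
    finally show "poly (P i j) t = poly ((\<Sum>p\<leftarrow>?ps. p i * p j) + [:1, 0, -1:] * (\<Sum>q\<leftarrow>?qs. q i * q j)) t"
      unfolding sum_list_scaled_products by (simp add: poly_sum_list comp_def field_simps)
  qed
  then show ?thesis
    using pq by (intro exI[of _ ?ps] exI[of _ ?qs]) (auto intro: poly_lt_smult)
qed

text \<open>
  As in the even case; now the products of \<open>c p\<close> with \<open>s q\<close> cancel.
\<close>
lemma interval_sos_odd:
  assumes d: "d = Suc (2 * m)"
  shows "\<exists>ps qs. (\<forall>p\<in>set ps. \<forall>i<n. p i \<in> poly_lt (Suc m)) \<and> (\<forall>q\<in>set qs. \<forall>i<n. q i \<in> poly_lt (Suc m)) \<and>
    (\<forall>i<n. \<forall>j<n. P i j = [:1, 1:] * (\<Sum>p\<leftarrow>ps. p i * p j) + [:1, -1:] * (\<Sum>q\<leftarrow>qs. q i * q j))"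
proof -
  obtain as where as: "\<And>a i. a \<in> set as \<Longrightarrow> i < n \<Longrightarrow> a i \<in> form d"
    "\<And>i j x. i < n \<Longrightarrow> j < n \<Longrightarrow> norm_sq x = 1 \<Longrightarrow> poly (P i j) (cos2 x) = (\<Sum>a\<leftarrow>as. a i x * a j x)"
    using sos_on_circle by blast
  have "\<forall>a i. \<exists>p q. a \<in> set as \<and> i < n \<longrightarrow> p \<in> poly_lt (Suc m) \<and> q \<in> poly_lt (Suc m) \<and>
      (\<forall>x. norm_sq x = 1 \<longrightarrow> a i x = fst x * poly p (cos2 x) + snd x * poly q (cos2 x))"
    using form_split_odd as(1) unfolding d by meson
  then obtain p q where pq: "\<And>a i. a \<in> set as \<Longrightarrow> i < n \<Longrightarrow> p a i \<in> poly_lt (Suc m) \<and> q a i \<in> poly_lt (Suc m)"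
    and a_eq: "\<And>a i x. a \<in> set as \<Longrightarrow> i < n \<Longrightarrow> norm_sq x = 1 \<Longrightarrow>
      a i x = fst x * poly (p a i) (cos2 x) + snd x * poly (q a i) (cos2 x)"
    by metis
  let ?h = "sqrt (1/2)"
  let ?ps = "map (\<lambda>a i. smult ?h (p a i)) as" and ?qs = "map (\<lambda>a i. smult ?h (q a i)) as"
  have h: "?h * ?h = 1/2" by (simp del: real_sqrt_divide)
  have "P i j = [:1, 1:] * (\<Sum>p\<leftarrow>?ps. p i * p j) + [:1, -1:] * (\<Sum>q\<leftarrow>?qs. q i * q j)" if ij: "i < n" "j < n" for i j
  proof (rule poly_eq_on_interval)
    fix t :: real assume "-1 \<le> t" "t \<le> 1"
    then obtain c s where cs: "c\<^sup>2 = (1 + t) / 2" "s\<^sup>2 = (1 - t) / 2"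
      "norm_sq (c, s) = 1" "cos2 (c, s) = t" "norm_sq (c, - s) = 1" "cos2 (c, - s) = t"
      by (rule circle_point)
    have "2 * poly (P i j) t = (\<Sum>a\<leftarrow>as. a i (c, s) * a j (c, s)) + (\<Sum>a\<leftarrow>as. a i (c, -s) * a j (c, -s))"
      using as(2)[OF ij cs(3)] as(2)[OF ij cs(5)] by (simp add: cs)
    also have "\<dots> = (\<Sum>a\<leftarrow>as. a i (c, s) * a j (c, s) + a i (c, -s) * a j (c, -s))"
      by (simp add: sum_list_addf)
    also have "\<dots> = (\<Sum>a\<leftarrow>as. 2 * c\<^sup>2 * poly (p a i * p a j) t + 2 * s\<^sup>2 * poly (q a i * q a j) t)"
    proof (intro arg_cong[where f = sum_list] map_cong refl)
      fix a assume a: "a \<in> set as"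
      show "a i (c, s) * a j (c, s) + a i (c, -s) * a j (c, -s) = 2 * c\<^sup>2 * poly (p a i * p a j) t + 2 * s\<^sup>2 * poly (q a i * q a j) t"
        unfolding a_eq[OF a ij(1) cs(3)] a_eq[OF a ij(2) cs(3)] a_eq[OF a ij(1) cs(5)] a_eq[OF a ij(2) cs(5)]
        by (simp add: cs(4,6) power2_eq_square algebra_simps)
    qed
    also have "\<dots> = 2 * c\<^sup>2 * (\<Sum>a\<leftarrow>as. poly (p a i * p a j) t) + 2 * s\<^sup>2 * (\<Sum>a\<leftarrow>as. poly (q a i * q a j) t)"
      by (simp only: sum_list_addf sum_list_const_mult)
    finally have "poly (P i j) t = (1 + t) * (?h * ?h) * (\<Sum>a\<leftarrow>as. poly (p a i * p a j) t) +
        (1 - t) * (?h * ?h) * (\<Sum>a\<leftarrow>as. poly (q a i * q a j) t)"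
      unfolding h cs(1,2) by (simp add: field_simps)
    then show "poly (P i j) t = poly ([:1, 1:] * (\<Sum>p\<leftarrow>?ps. p i * p j) + [:1, -1:] * (\<Sum>q\<leftarrow>?qs. q i * q j)) t"
      unfolding sum_list_scaled_products
      by (simp only: poly_add poly_mult poly_smult poly_sum_list poly_pCons poly_0) (simp add: algebra_simps del: real_sqrt_divide)
  qed
  then show ?thesis
    using pq by (intro exI[of _ ?ps] exI[of _ ?qs]) (auto intro: poly_lt_smult)
qed

end

section \<open>Gram matrices and the certificate\<close>

text \<open>
  The matrix \<open>\<Sum> a a\<^sup>T\<close>. It is used over the polynomials for \<open>X\<^sub>1\<close> and \<open>X\<^sub>2\<close> and over the reals for
  \<open>Q\<^sub>1\<close> and \<open>Q\<^sub>2\<close>.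
\<close>
definition gram_mat :: "nat \<Rightarrow> (nat \<Rightarrow> 'a :: comm_ring_1) list \<Rightarrow> 'a mat" where
  "gram_mat N as = mat N N (\<lambda>(i, j). \<Sum>a\<leftarrow>as. a i * a j)"

lemma gram_mat_carrier: "gram_mat N as \<in> carrier_mat N N"
  by (simp add: gram_mat_def)

lemma symmetric_gram_mat: "symmetric_mat (gram_mat N as)"
  by (auto simp: symmetric_mat_def gram_mat_def transpose_mat_def mult.commute)

lemma scalar_prod_mult_mat_vec:
  fixes A :: "real mat"
  assumes "A \<in> carrier_mat N N" "z \<in> carrier_vec N"
  shows "z \<bullet> (A *\<^sub>v z) = quad {..<N} (\<lambda>i j. A $$ (i, j)) (\<lambda>i. z $ i)"
  using assms
  by (simp add: scalar_prod_def quad_def sum_distrib_left mult_ac atLeast0LessThan)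

lemma scalar_prod_gram_mat:
  fixes as :: "(nat \<Rightarrow> real) list"
  assumes z: "z \<in> carrier_vec N"
  shows "z \<bullet> (gram_mat N as *\<^sub>v z) = (\<Sum>a\<leftarrow>as. (\<Sum>i<N. a i * z $ i)\<^sup>2)"
proof -
  have "z \<bullet> (gram_mat N as *\<^sub>v z) = (\<Sum>i<N. \<Sum>j<N. \<Sum>a\<leftarrow>as. (a i * z $ i) * (a j * z $ j))"
    unfolding scalar_prod_mult_mat_vec[OF gram_mat_carrier z] quad_def
    by (intro sum.cong refl) (simp add: gram_mat_def mult_ac flip: sum_list_const_mult)
  also have "\<dots> = (\<Sum>a\<leftarrow>as. \<Sum>i<N. \<Sum>j<N. (a i * z $ i) * (a j * z $ j))"
    by (induction as) (simp_all add: sum.distrib)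
  also have "\<dots> = (\<Sum>a\<leftarrow>as. (\<Sum>i<N. a i * z $ i)\<^sup>2)"
    by (simp only: sum_product power2_eq_square)
  finally show ?thesis .
qed

lemma psd_gram_mat: "psd_mat (gram_mat N (as :: (nat \<Rightarrow> real) list))"
  unfolding psd_mat_def
proof (intro conjI ballI symmetric_gram_mat)
  fix x :: "real vec" assume "x \<in> carrier_vec (dim_row (gram_mat N as))"
  then have "x \<in> carrier_vec N" by (simp add: gram_mat_def)
  from scalar_prod_gram_mat[OF this]
  show "0 \<le> x \<bullet> (gram_mat N as *\<^sub>v x)"
    by (auto intro!: sum_list_nonneg)
qed

lemma eval_gram_mat: "eval_poly_mat (gram_mat n ps) t = gram_mat n (map (\<lambda>p i. poly (p i) t) ps)"
  by (rule eq_matI) (auto simp: eval_poly_mat_def gram_mat_def poly_sum_list comp_def)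

text \<open>
  The coefficients of a vector of polynomials, ordered as the monomials in \<open>monom_vec\<close>.
\<close>
definition coeff_vec :: "nat \<Rightarrow> (nat \<Rightarrow> real poly) \<Rightarrow> nat \<Rightarrow> real" where
  "coeff_vec n p \<alpha> = coeff (p (\<alpha> mod n)) (\<alpha> div n)"

lemma sum_coeff_vec_monom_vec:
  assumes p: "\<And>i. i < n \<Longrightarrow> p i \<in> poly_lt k" and y: "y \<in> carrier_vec n"
  shows "(\<Sum>\<alpha><k * n. coeff_vec n p \<alpha> * monom_vec (int k - 1) t y $ \<alpha>) = (\<Sum>i<n. poly (p i) t * y $ i)"
proof -
  let ?f = "\<lambda>r i. coeff (p i) r * (y $ i * t ^ r)"
  have "(\<Sum>\<alpha><k * n. coeff_vec n p \<alpha> * monom_vec (int k - 1) t y $ \<alpha>) =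
      (\<Sum>\<alpha><k * n. ?f (\<alpha> div n) (\<alpha> mod n))"
    using y by (intro sum.cong refl) (simp add: monom_vec_def coeff_vec_def)
  also have "\<dots> = (\<Sum>r<k. \<Sum>\<alpha> = r * n..<r * n + n. ?f (\<alpha> div n) (\<alpha> mod n))"
    by (rule sum.nat_group[symmetric])
  also have "\<dots> = (\<Sum>r<k. \<Sum>i<n. ?f r i)"
  proof (rule sum.cong[OF refl])
    fix r
    have "(\<Sum>\<alpha> = r * n..<r * n + n. ?f (\<alpha> div n) (\<alpha> mod n)) =
        (\<Sum>i<n. ?f ((i + r * n) div n) ((i + r * n) mod n))"
      using sum.shift_bounds_nat_ivl[of "\<lambda>\<alpha>. ?f (\<alpha> div n) (\<alpha> mod n)" 0 "r * n" n]
      by (simp add: atLeast0LessThan add.commute)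
    also have "\<dots> = (\<Sum>i<n. ?f r i)"
      by (intro sum.cong refl) simp
    finally show "(\<Sum>\<alpha> = r * n..<r * n + n. ?f (\<alpha> div n) (\<alpha> mod n)) = (\<Sum>i<n. ?f r i)" .
  qed
  also have "\<dots> = (\<Sum>i<n. \<Sum>r<k. ?f r i)"
    by (rule sum.swap)
  also have "\<dots> = (\<Sum>i<n. poly (p i) t * y $ i)"
    by (intro sum.cong refl) (simp add: poly_eq_sum_lt[OF p] sum_distrib_left mult_ac)
  finally show ?thesis .
qed

text \<open>
  Both sides are \<open>\<Sum> (\<Sum> p i(t) y i)\<^sup>2\<close> over all \<open>p\<close>: the vector of monomials turns coefficients into
  values.
\<close>
lemma gram_mat_monom_vec:
  assumes ps: "\<forall>p\<in>set ps. \<forall>i<n. p i \<in> poly_lt k" and y: "y \<in> carrier_vec n"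
  shows "y \<bullet> (eval_poly_mat (gram_mat n ps) t *\<^sub>v y) =
    monom_vec (int k - 1) t y \<bullet> (gram_mat (k * n) (map (coeff_vec n) ps) *\<^sub>v monom_vec (int k - 1) t y)"
proof -
  have v: "monom_vec (int k - 1) t y \<in> carrier_vec (k * n)"
    using y by (simp add: monom_vec_def)
  show ?thesis
    unfolding eval_gram_mat scalar_prod_gram_mat[OF y] scalar_prod_gram_mat[OF v] map_map comp_def
  proof (intro arg_cong[where f = sum_list] map_cong refl)
    fix p assume "p \<in> set ps"
    then show "(\<Sum>i<n. poly (p i) t * y $ i)\<^sup>2 =
        (\<Sum>\<alpha><k * n. coeff_vec n p \<alpha> * monom_vec (int k - 1) t y $ \<alpha>)\<^sup>2"
      using ps by (subst sum_coeff_vec_monom_vec[OF _ y]) auto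
  qed
qed

lemma psd_mat_iff_quad:
  assumes A: "A \<in> carrier_mat n n"
  shows "psd_mat A \<longleftrightarrow> symmetric_mat A \<and> (\<forall>z. 0 \<le> quad {..<n} (\<lambda>i j. A $$ (i, j)) z)"
proof -
  have "quad {..<n} (\<lambda>i j. A $$ (i, j)) z = vec n z \<bullet> (A *\<^sub>v vec n z)" for z
    by (subst scalar_prod_mult_mat_vec[OF A]) (simp_all add: quad_def)
  then have "(\<forall>z. 0 \<le> quad {..<n} (\<lambda>i j. A $$ (i, j)) z) \<longleftrightarrow>
      (\<forall>x\<in>carrier_vec n. 0 \<le> x \<bullet> (A *\<^sub>v x))"
    using scalar_prod_mult_mat_vec[OF A] vec_carrier by metis
  then show ?thesis
    using A by (simp add: psd_mat_def)
qed

lemma poly_lt_degree_poly_mat: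
  assumes "P \<in> carrier_mat n n" "i < n" "j < n"
  shows "P $$ (i, j) \<in> poly_lt (Suc (degree_poly_mat P))"
proof -
  have "P $$ (i, j) \<in> elements_mat P"
    using assms by (intro elements_matI[of P n n i j]) auto
  then have "degree (P $$ (i, j)) \<le> degree_poly_mat P"
    unfolding degree_poly_mat_def by (intro Max_ge) (auto simp: elements_mat_def)
  then show ?thesis
    by (auto simp: poly_lt_def intro: coeff_eq_0)
qed

lemma eval_poly_mat_symmetric: "symmetric_mat P \<Longrightarrow> symmetric_mat (eval_poly_mat P t)"
  by (simp add: symmetric_mat_def eval_poly_mat_def map_mat_transpose)

lemma psd_mat_weighted_sum:
  assumes P: "P \<in> carrier_mat n n" "symmetric_mat P"
    and A: "A \<in> carrier_mat n n" and B: "B \<in> carrier_mat n n"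
    and eq: "P = a \<cdot>\<^sub>m A + b \<cdot>\<^sub>m B" and "0 \<le> a" "0 \<le> b"
    and psd: "\<And>y. y \<in> carrier_vec n \<Longrightarrow> 0 \<le> y \<bullet> (A *\<^sub>v y)" "\<And>y. y \<in> carrier_vec n \<Longrightarrow> 0 \<le> y \<bullet> (B *\<^sub>v y)"
  shows "psd_mat P"
proof -
  have "0 \<le> quad {..<n} (\<lambda>i j. P $$ (i, j)) z" for z
  proof -
    have "quad {..<n} (\<lambda>i j. P $$ (i, j)) z =
        a * quad {..<n} (\<lambda>i j. A $$ (i, j)) z + b * quad {..<n} (\<lambda>i j. B $$ (i, j)) z"
      unfolding quad_def sum_distrib_left sum.distrib[symmetric] eq
      using A B by (intro sum.cong refl) (simp add: algebra_simps)
    moreover have "0 \<le> quad {..<n} (\<lambda>i j. A $$ (i, j)) z" "0 \<le> quad {..<n} (\<lambda>i j. B $$ (i, j)) z"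
      using psd[of "vec n z"] scalar_prod_mult_mat_vec[OF A, of "vec n z"]
        scalar_prod_mult_mat_vec[OF B, of "vec n z"] by (simp_all add: quad_def)
    ultimately show ?thesis using assms(6,7) by simp
  qed
  then show ?thesis using P by (simp add: psd_mat_iff_quad)
qed

lemma psd_mat_quad_nonneg:
  assumes "psd_mat Q" "Q \<in> carrier_mat N N" "v \<in> carrier_vec N"
  shows "0 \<le> v \<bullet> (Q *\<^sub>v v)"
  using assms by (auto simp: psd_mat_def)

lemma monom_vec_carrier: "y \<in> carrier_vec n \<Longrightarrow> monom_vec d' t y \<in> carrier_vec (nat (d' + 1) * n)"
  by (simp add: monom_vec_def)

text \<open>
  Both parities of the degree at once: they differ only in the weights, in the sizes and in
  the sum-of-squares theorem that supplies the squares.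
\<close>
lemma gram_certificate_iff:
  fixes P :: "real poly mat"
  assumes P_dim: "P \<in> carrier_mat n n" and P_sym: "symmetric_mat P"
    and weights: "\<And>t. t \<in> {-1..1} \<Longrightarrow> 0 \<le> poly w1 t \<and> 0 \<le> poly w2 t"
    and sos: "\<forall>t \<in> {-1..1}. psd_mat (eval_poly_mat P t) \<Longrightarrow>
      \<exists>ps qs. (\<forall>p\<in>set ps. \<forall>i<n. p i \<in> poly_lt k1) \<and> (\<forall>q\<in>set qs. \<forall>i<n. q i \<in> poly_lt k2) \<and>
        (\<forall>i<n. \<forall>j<n. P $$ (i, j) = w1 * (\<Sum>p\<leftarrow>ps. p i * p j) + w2 * (\<Sum>q\<leftarrow>qs. q i * q j))"
  shows "(\<forall>t \<in> {-1..1}. psd_mat (eval_poly_mat P t)) \<longleftrightarrow>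
    (\<exists>Q1 Q2 X1 X2.
       Q1 \<in> carrier_mat (k1 * n) (k1 * n) \<and> psd_mat Q1 \<and>
       Q2 \<in> carrier_mat (k2 * n) (k2 * n) \<and> psd_mat Q2 \<and>
       X1 \<in> carrier_mat n n \<and> symmetric_mat X1 \<and>
       X2 \<in> carrier_mat n n \<and> symmetric_mat X2 \<and>
       (\<forall>t::real. \<forall>y \<in> carrier_vec n.
          eval_poly_mat P t =
            poly w1 t \<cdot>\<^sub>m eval_poly_mat X1 t + poly w2 t \<cdot>\<^sub>m eval_poly_mat X2 t \<and>
          y \<bullet> (eval_poly_mat X1 t *\<^sub>v y) =
            monom_vec (int k1 - 1) t y \<bullet> (Q1 *\<^sub>v monom_vec (int k1 - 1) t y) \<and>
          y \<bullet> (eval_poly_mat X2 t *\<^sub>v y) =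
            monom_vec (int k2 - 1) t y \<bullet> (Q2 *\<^sub>v monom_vec (int k2 - 1) t y)))"
  (is "?psd \<longleftrightarrow> ?cert")
proof
  assume ?psd
  from sos[OF this] obtain ps qs where ps: "\<forall>p\<in>set ps. \<forall>i<n. p i \<in> poly_lt k1" and
    qs: "\<forall>q\<in>set qs. \<forall>i<n. q i \<in> poly_lt k2" and
    P_eq: "\<forall>i<n. \<forall>j<n. P $$ (i, j) = w1 * (\<Sum>p\<leftarrow>ps. p i * p j) + w2 * (\<Sum>q\<leftarrow>qs. q i * q j)"
    by blast
  have "eval_poly_mat P t = poly w1 t \<cdot>\<^sub>m eval_poly_mat (gram_mat n ps) t
      + poly w2 t \<cdot>\<^sub>m eval_poly_mat (gram_mat n qs) t" for t
    using P_dim by (intro eq_matI) (auto simp: eval_poly_mat_def gram_mat_def P_eq)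
  then show ?cert
    by (intro exI[of _ "gram_mat (k1 * n) (map (coeff_vec n) ps)"]
        exI[of _ "gram_mat (k2 * n) (map (coeff_vec n) qs)"] exI[of _ "gram_mat n ps"] exI[of _ "gram_mat n qs"]
        conjI gram_mat_carrier psd_gram_mat symmetric_gram_mat allI ballI
        gram_mat_monom_vec[OF ps] gram_mat_monom_vec[OF qs])
next
  assume ?cert
  then obtain Q1 Q2 X1 X2 where
    Q: "Q1 \<in> carrier_mat (k1 * n) (k1 * n)" "psd_mat Q1" "Q2 \<in> carrier_mat (k2 * n) (k2 * n)" "psd_mat Q2" and
    X: "X1 \<in> carrier_mat n n" "X2 \<in> carrier_mat n n" and
    cert: "\<forall>t::real. \<forall>y \<in> carrier_vec n.
          eval_poly_mat P t =
            poly w1 t \<cdot>\<^sub>m eval_poly_mat X1 t + poly w2 t \<cdot>\<^sub>m eval_poly_mat X2 t \<and>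
          y \<bullet> (eval_poly_mat X1 t *\<^sub>v y) =
            monom_vec (int k1 - 1) t y \<bullet> (Q1 *\<^sub>v monom_vec (int k1 - 1) t y) \<and>
          y \<bullet> (eval_poly_mat X2 t *\<^sub>v y) =
            monom_vec (int k2 - 1) t y \<bullet> (Q2 *\<^sub>v monom_vec (int k2 - 1) t y)"
    by (elim exE conjE)
  have carrier: "eval_poly_mat X t \<in> carrier_mat n n" if "X \<in> carrier_mat n n" for X t
    using that by (simp add: eval_poly_mat_def)
  show ?psd
  proof
    fix t :: real assume t: "t \<in> {-1..1}"
    have nonneg: "0 \<le> monom_vec (int k - 1) t y \<bullet> (Q *\<^sub>v monom_vec (int k - 1) t y)"
      if "psd_mat Q" "Q \<in> carrier_mat (k * n) (k * n)" "y \<in> carrier_vec n" for Q k y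
      using psd_mat_quad_nonneg[OF that(1,2)] monom_vec_carrier[OF that(3), of "int k - 1" t] by simp
    have "0\<^sub>v n \<in> carrier_vec n" by simp
    then have "eval_poly_mat P t =
        poly w1 t \<cdot>\<^sub>m eval_poly_mat X1 t + poly w2 t \<cdot>\<^sub>m eval_poly_mat X2 t"
      using cert by blast
    then show "psd_mat (eval_poly_mat P t)"
    proof (rule psd_mat_weighted_sum[OF carrier[OF P_dim] eval_poly_mat_symmetric[OF P_sym]
          carrier[OF X(1)] carrier[OF X(2)]])
      fix y :: "real vec" assume y: "y \<in> carrier_vec n"
      show "0 \<le> y \<bullet> (eval_poly_mat X1 t *\<^sub>v y)" "0 \<le> y \<bullet> (eval_poly_mat X2 t *\<^sub>v y)"
        using cert y nonneg[OF Q(2,1) y] nonneg[OF Q(4,3) y] by simp_all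
    qed (use weights[OF t] in auto)
  qed
qed

theorem proposition3p5:
  fixes P :: "real poly mat" and n d :: nat
  assumes P_dim: "P \<in> carrier_mat n n"
    and P_sym: "symmetric_mat P"
    and P_deg: "degree_poly_mat P = d"
  shows
    "(odd d \<longrightarrow>
       ((\<forall>t \<in> {-1..1}. psd_mat (eval_poly_mat P t)) \<longleftrightarrow>
        (\<exists>Q1 Q2 X1 X2.
           Q1 \<in> carrier_mat ((d + 1) div 2 * n) ((d + 1) div 2 * n) \<and> psd_mat Q1 \<and>
           Q2 \<in> carrier_mat ((d + 1) div 2 * n) ((d + 1) div 2 * n) \<and> psd_mat Q2 \<and>
           X1 \<in> carrier_mat n n \<and> symmetric_mat X1 \<and>
           X2 \<in> carrier_mat n n \<and> symmetric_mat X2 \<and>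
           (\<forall>t::real. \<forall>y \<in> carrier_vec n.
              eval_poly_mat P t =
                (t + 1) \<cdot>\<^sub>m eval_poly_mat X1 t + (1 - t) \<cdot>\<^sub>m eval_poly_mat X2 t \<and>
              y \<bullet> (eval_poly_mat X1 t *\<^sub>v y) =
                monom_vec ((int d - 1) div 2) t y \<bullet> (Q1 *\<^sub>v monom_vec ((int d - 1) div 2) t y) \<and>
              y \<bullet> (eval_poly_mat X2 t *\<^sub>v y) =
                monom_vec ((int d - 1) div 2) t y \<bullet> (Q2 *\<^sub>v monom_vec ((int d - 1) div 2) t y)))))
     \<and>
     (even d \<longrightarrow>
       ((\<forall>t \<in> {-1..1}. psd_mat (eval_poly_mat P t)) \<longleftrightarrow>
        (\<exists>Q1 Q2 X1 X2.
           Q1 \<in> carrier_mat ((d div 2 + 1) * n) ((d div 2 + 1) * n) \<and> psd_mat Q1 \<and>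
           Q2 \<in> carrier_mat (d div 2 * n) (d div 2 * n) \<and> psd_mat Q2 \<and>
           X1 \<in> carrier_mat n n \<and> symmetric_mat X1 \<and>
           X2 \<in> carrier_mat n n \<and> symmetric_mat X2 \<and>
           (\<forall>t::real. \<forall>y \<in> carrier_vec n.
              eval_poly_mat P t =
                eval_poly_mat X1 t + (1 - t\<^sup>2) \<cdot>\<^sub>m eval_poly_mat X2 t \<and>
              y \<bullet> (eval_poly_mat X1 t *\<^sub>v y) =
                monom_vec (int d div 2) t y \<bullet> (Q1 *\<^sub>v monom_vec (int d div 2) t y) \<and>
              y \<bullet> (eval_poly_mat X2 t *\<^sub>v y) =
                monom_vec (int d div 2 - 1) t y \<bullet> (Q2 *\<^sub>v monom_vec (int d div 2 - 1) t y)))))"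
proof -
  have deg: "P $$ (i, j) \<in> poly_lt (Suc d)" if "i < n" "j < n" for i j
    using poly_lt_degree_poly_mat[OF P_dim that] P_deg by simp
  have sym: "P $$ (i, j) = P $$ (j, i)" if "i < n" "j < n" for i j
  proof -
    have "P $$ (i, j) = P\<^sup>T $$ (i, j)" using P_sym by (simp add: symmetric_mat_def)
    then show ?thesis using that P_dim by simp
  qed
  have psd: "0 \<le> quad {..<n} (\<lambda>i j. poly (P $$ (i, j)) t) z"
    if "\<forall>t\<in>{-1..1}. psd_mat (eval_poly_mat P t)" "-1 \<le> t" "t \<le> 1" for t z
  proof -
    have "psd_mat (eval_poly_mat P t)" using that by simp
    moreover have "eval_poly_mat P t \<in> carrier_mat n n" using P_dim by (simp add: eval_poly_mat_def)
    ultimately have "0 \<le> quad {..<n} (\<lambda>i j. eval_poly_mat P t $$ (i, j)) z"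
      using psd_mat_iff_quad by blast
    then show ?thesis using P_dim by (simp add: quad_def eval_poly_mat_def)
  qed
  show ?thesis
  proof (intro conjI impI)
    assume "odd d"
    then obtain m where m: "d = Suc (2 * m)" by (elim oddE) simp
    have size: "(d + 1) div 2 = Suc m" and index: "(int d - 1) div 2 = int (Suc m) - 1"
      by (simp_all add: m)
    have weight: "poly [:1, 1:] t = t + 1" "poly [:1, -1:] t = 1 - t" for t :: real
      by simp_all
    show "((\<forall>t \<in> {-1..1}. psd_mat (eval_poly_mat P t)) \<longleftrightarrow>
        (\<exists>Q1 Q2 X1 X2.
           Q1 \<in> carrier_mat ((d + 1) div 2 * n) ((d + 1) div 2 * n) \<and> psd_mat Q1 \<and>
           Q2 \<in> carrier_mat ((d + 1) div 2 * n) ((d + 1) div 2 * n) \<and> psd_mat Q2 \<and>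
           X1 \<in> carrier_mat n n \<and> symmetric_mat X1 \<and>
           X2 \<in> carrier_mat n n \<and> symmetric_mat X2 \<and>
           (\<forall>t::real. \<forall>y \<in> carrier_vec n.
              eval_poly_mat P t =
                (t + 1) \<cdot>\<^sub>m eval_poly_mat X1 t + (1 - t) \<cdot>\<^sub>m eval_poly_mat X2 t \<and>
              y \<bullet> (eval_poly_mat X1 t *\<^sub>v y) =
                monom_vec ((int d - 1) div 2) t y \<bullet> (Q1 *\<^sub>v monom_vec ((int d - 1) div 2) t y) \<and>
              y \<bullet> (eval_poly_mat X2 t *\<^sub>v y) =
                monom_vec ((int d - 1) div 2) t y \<bullet> (Q2 *\<^sub>v monom_vec ((int d - 1) div 2) t y))))"
      unfolding size index weight[symmetric]
      by (rule gram_certificate_iff[OF P_dim P_sym])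
        (use interval_sos_odd[where P = "\<lambda>i j. P $$ (i, j)", OF deg sym psd m] in auto)
  next
    assume "even d"
    then obtain m where m: "d = 2 * m" by (elim evenE)
    have size: "d div 2 + 1 = Suc m" "d div 2 = m"
      and index: "int d div 2 - 1 = int m - 1" "int d div 2 = int (Suc m) - 1"
      by (simp_all add: m)
    have weight: "poly [:1, 0, -1:] t = 1 - t\<^sup>2" for t :: real
      by (simp add: power2_eq_square)
    have even_iff: "(\<forall>t \<in> {-1..1}. psd_mat (eval_poly_mat P t)) \<longleftrightarrow>
        (\<exists>Q1 Q2 X1 X2.
           Q1 \<in> carrier_mat (Suc m * n) (Suc m * n) \<and> psd_mat Q1 \<and>
           Q2 \<in> carrier_mat (m * n) (m * n) \<and> psd_mat Q2 \<and>
           X1 \<in> carrier_mat n n \<and> symmetric_mat X1 \<and>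
           X2 \<in> carrier_mat n n \<and> symmetric_mat X2 \<and>
           (\<forall>t::real. \<forall>y \<in> carrier_vec n.
              eval_poly_mat P t =
                poly 1 t \<cdot>\<^sub>m eval_poly_mat X1 t + poly [:1, 0, -1:] t \<cdot>\<^sub>m eval_poly_mat X2 t \<and>
              y \<bullet> (eval_poly_mat X1 t *\<^sub>v y) =
                monom_vec (int (Suc m) - 1) t y \<bullet> (Q1 *\<^sub>v monom_vec (int (Suc m) - 1) t y) \<and>
              y \<bullet> (eval_poly_mat X2 t *\<^sub>v y) =
                monom_vec (int m - 1) t y \<bullet> (Q2 *\<^sub>v monom_vec (int m - 1) t y)))"
    proof (rule gram_certificate_iff[OF P_dim P_sym])
      show "0 \<le> poly 1 t \<and> 0 \<le> poly [:1, 0, -1:] t" if "t \<in> {-1..1}" for t :: real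
        using that by (simp add: weight abs_square_le_1 abs_le_iff del: poly_pCons)
    qed (use interval_sos_even[where P = "\<lambda>i j. P $$ (i, j)", OF deg sym psd m] in simp)
    have one: "poly 1 t \<cdot>\<^sub>m A = A" for t :: real and A :: "real mat"
      by auto
    show "((\<forall>t \<in> {-1..1}. psd_mat (eval_poly_mat P t)) \<longleftrightarrow>
        (\<exists>Q1 Q2 X1 X2.
           Q1 \<in> carrier_mat ((d div 2 + 1) * n) ((d div 2 + 1) * n) \<and> psd_mat Q1 \<and>
           Q2 \<in> carrier_mat (d div 2 * n) (d div 2 * n) \<and> psd_mat Q2 \<and>
           X1 \<in> carrier_mat n n \<and> symmetric_mat X1 \<and>
           X2 \<in> carrier_mat n n \<and> symmetric_mat X2 \<and>
           (\<forall>t::real. \<forall>y \<in> carrier_vec n.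
              eval_poly_mat P t =
                eval_poly_mat X1 t + (1 - t\<^sup>2) \<cdot>\<^sub>m eval_poly_mat X2 t \<and>
              y \<bullet> (eval_poly_mat X1 t *\<^sub>v y) =
                monom_vec (int d div 2) t y \<bullet> (Q1 *\<^sub>v monom_vec (int d div 2) t y) \<and>
              y \<bullet> (eval_poly_mat X2 t *\<^sub>v y) =
                monom_vec (int d div 2 - 1) t y \<bullet> (Q2 *\<^sub>v monom_vec (int d div 2 - 1) t y))))"
      unfolding size(1) index(1) unfolding size(2) index(2) by (rule even_iff[unfolded one weight])
  qed
qed

end
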